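(* Let $p\in(1,\infty)$, let $\mu_1,\dots,\mu_N\in\mathcal P(\Omega)$ and let $(\lambda_i)_{i\in[N]}\in\Delta_N$. Then $$\mathrm{wMM}(\mu_1,\dots,\mu_N)=\mathrm{wD}(\mu_1,\dots,\mu_N)=\mathrm{wDr}(\mu_1,\dots,\mu_N).$$
   Context: $\Omega\subset\mathbb R^d$ is a fixed compact convex set, $\mathcal P(\Omega)$ is the set of Borel probability measures on $\Omega$, and $0\le M\le N$ are fixed integers with $N>0$. $[N]=\{1,\dots,N\}$ and $\Delta_N=\{(\lambda_i)_{i\in[N]}\in(0,1)^N:\sum_{i=1}^N\lambda_i=1\}$. Convex order: for $\eta,\mu\in\mathcal P(\Omega)$, $\eta\le_{cx}\mu$ means $\int_\Omega\varphi\,d\eta\le\int_\Omega\varphi\,d\mu$ for all convex $\varphi:\mathbb R^d\to\mathbb R$. With $\pi_i:\Omega^N\to\Omega$ the projection on the $i$-th factor and $\#$ denoting pushforward, set $$\Pi:=\{\gamma\in\mathcal P(\Omega^N):\ \mu_i\le_{cx}\pi_{i\#}\gamma\ \text{for } i=1,\dots,M;\ \ \pi_{i\#}\gamma\le_{cx}\mu_i\ \text{for } i=M+1,\dots,N\}.$$ Infimal convolution cost: $\bar c(x_1,\dots,x_N)=\inf_{z\in\Omega}\sum_{i=1}^N\lambda_i|x_i-z|^p$ for $(x_1,\dots,x_N)\in\Omega^N$. Multi-marginal problem: $\mathrm{wMM}(\mu_1,\dots,\mu_N)=\inf_{\gamma\in\Pi}\int_{\Omega^N}\bar c\,d\gamma$.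 Dual problem: $\mathrm{wD}(\mu_1,\dots,\mu_N)=\sup_{(\varphi_i)\in\mathcal A_{\bar c}}\sum_{i=1}^N\int_\Omega\varphi_i\,d\mu_i$, where $\mathcal A_{\bar c}$ is the set of $(\varphi_i)_{i\in[N]}\in C(\Omega)^N$ such that $\sum_{i=1}^N\varphi_i(x_i)\le\bar c(x_1,\dots,x_N)$ for all $(x_1,\dots,x_N)\in\Omega^N$, $\varphi_i$ is convex for $i=1,\dots,M$, and $\varphi_i$ is concave for $i=M+1,\dots,N$. Relaxed dual problem: for $i=M+1,\dots,N$ let $K_i=\mathrm{conv}(\mathrm{supp}(\mu_i))$. Then $$\mathrm{wDr}(\mu_1,\dots,\mu_N)=\sup_{(\varphi_i)\in\mathcal B_{\bar c}}\ \sum_{i=1}^M\int_\Omega\varphi_i\,d\mu_i+\sum_{i=M+1}^N\int_{K_i}\varphi_i\,d\mu_i,$$ where $\mathcal B_{\bar c}$ is the set of $(\varphi_i)_{i\in[N]}$ such that: $\varphi_i:\Omega\to\mathbb R$ is convex and continuous for $i=1,\dots,M$; $\varphi_i:K_i\to\mathbb R\cup\{-\infty\}$ is concave, upper semicontinuous and in $L^1(\mu_i)$ for $i=M+1,\dots,N$; and $\sum_{i=1}^N\varphi_i(x_i)\le\bar c(x_1,\dots,x_N)$ for all $(x_1,\dots,x_N)\in\Omega^M\times K_{M+1}\times\dots\times K_N$. *)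

theory Defs
  imports "HOL-Probability.Probability"
begin

definition borel_probs :: "'a::topological_space set \<Rightarrow> 'a measure set" where
  "borel_probs \<Omega> = {\<mu>. prob_space \<mu> \<and> sets \<mu> = sets (restrict_space borel \<Omega>)}"

(* The product sigma-algebra on \<Omega>^N is the Borel one, since \<Omega> is second countable.
   The points of \<Omega>^N are the extensional functions on {1..N} with values in \<Omega>. *)
definition borel_probs_prod :: "'a::euclidean_space set \<Rightarrow> nat \<Rightarrow> (nat \<Rightarrow> 'a) measure set" where
  "borel_probs_prod \<Omega> N =
     {\<gamma>. prob_space \<gamma> \<and> sets \<gamma> = sets (PiM {1..N} (\<lambda>_. restrict_space borel \<Omega>))}"

definition cx_le :: "'a::euclidean_space measure \<Rightarrow> 'a measure \<Rightarrow> bool"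
    (infix "\<le>cx" 50) where
  "\<eta> \<le>cx \<mu> \<longleftrightarrow>
     (\<forall>\<phi>::'a \<Rightarrow> real. convex_on UNIV \<phi> \<longrightarrow> (\<integral>x. \<phi> x \<partial>\<eta>) \<le> (\<integral>x. \<phi> x \<partial>\<mu>))"

definition marginal :: "'a::euclidean_space set \<Rightarrow> nat \<Rightarrow> (nat \<Rightarrow> 'a) measure \<Rightarrow> 'a measure" where
  "marginal \<Omega> i \<gamma> = distr \<gamma> (restrict_space borel \<Omega>) (\<lambda>x. x i)"

definition cx_plans ::
    "'a::euclidean_space set \<Rightarrow> nat \<Rightarrow> nat \<Rightarrow> (nat \<Rightarrow> 'a measure) \<Rightarrow> (nat \<Rightarrow> 'a) measure set" where
  "cx_plans \<Omega> M N \<mu> = {\<gamma> \<in> borel_probs_prod \<Omega> N.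
     (\<forall>i\<in>{1..M}. \<mu> i \<le>cx marginal \<Omega> i \<gamma>) \<and>
     (\<forall>i\<in>{M+1..N}. marginal \<Omega> i \<gamma> \<le>cx \<mu> i)}"

definition cbar ::
    "'a::euclidean_space set \<Rightarrow> nat \<Rightarrow> real \<Rightarrow> (nat \<Rightarrow> real) \<Rightarrow> (nat \<Rightarrow> 'a) \<Rightarrow> real" where
  "cbar \<Omega> N p w x = (INF z\<in>\<Omega>. \<Sum>i=1..N. w i * norm (x i - z) powr p)"

(* The optimal values are taken in the extended reals, so that no boundedness or
   nonemptiness of the feasible sets is presupposed. *)
definition wMM ::
    "'a::euclidean_space set \<Rightarrow> nat \<Rightarrow> nat \<Rightarrow> real \<Rightarrow> (nat \<Rightarrow> real) \<Rightarrow> (nat \<Rightarrow> 'a measure) \<Rightarrow> ereal" where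
  "wMM \<Omega> M N p w \<mu> = (INF \<gamma>\<in>cx_plans \<Omega> M N \<mu>. ereal (\<integral>x. cbar \<Omega> N p w x \<partial>\<gamma>))"

definition dual_admissible ::
    "'a::euclidean_space set \<Rightarrow> nat \<Rightarrow> nat \<Rightarrow> real \<Rightarrow> (nat \<Rightarrow> real) \<Rightarrow> (nat \<Rightarrow> 'a \<Rightarrow> real) set" where
  "dual_admissible \<Omega> M N p w = {\<phi>.
     (\<forall>i\<in>{1..N}. continuous_on \<Omega> (\<phi> i)) \<and>
     (\<forall>x \<in> PiE {1..N} (\<lambda>_. \<Omega>). (\<Sum>i=1..N. \<phi> i (x i)) \<le> cbar \<Omega> N p w x) \<and>
     (\<forall>i\<in>{1..M}. convex_on \<Omega> (\<phi> i)) \<and>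
     (\<forall>i\<in>{M+1..N}. concave_on \<Omega> (\<phi> i))}"

definition wD ::
    "'a::euclidean_space set \<Rightarrow> nat \<Rightarrow> nat \<Rightarrow> real \<Rightarrow> (nat \<Rightarrow> real) \<Rightarrow> (nat \<Rightarrow> 'a measure) \<Rightarrow> ereal" where
  "wD \<Omega> M N p w \<mu> =
     (SUP \<phi>\<in>dual_admissible \<Omega> M N p w. ereal (\<Sum>i=1..N. \<integral>x. \<phi> i x \<partial>\<mu> i))"

definition msupp :: "'a::topological_space measure \<Rightarrow> 'a set" where
  "msupp \<mu> = {x \<in> space \<mu>. \<forall>U. open U \<and> x \<in> U \<longrightarrow> emeasure \<mu> (U \<inter> space \<mu>) > 0}"

definition supp_hull :: "'a::euclidean_space measure \<Rightarrow> 'a set" where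
  "supp_hull \<mu> = convex hull (msupp \<mu>)"

(* Intended for functions without the value \<infinity>, where the sum is unambiguous.
   At u = 0 or v = 0 the convention 0 * (-\<infinity>) = 0 makes the inequality trivial. *)
definition ereal_concave_on :: "'a::real_vector set \<Rightarrow> ('a \<Rightarrow> ereal) \<Rightarrow> bool" where
  "ereal_concave_on S f \<longleftrightarrow> convex S \<and>
     (\<forall>x\<in>S. \<forall>y\<in>S. \<forall>u\<ge>0. \<forall>v\<ge>0. u + v = 1 \<longrightarrow>
        ereal u * f x + ereal v * f y \<le> f (u *\<^sub>R x + v *\<^sub>R y))"

definition usc_on :: "'a::topological_space set \<Rightarrow> ('a \<Rightarrow> ereal) \<Rightarrow> bool" where
  "usc_on S f \<longleftrightarrow> (\<forall>a. openin (top_of_set S) {x \<in> S. f x < a})"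

(* real_of_ereal sends -\<infinity> to 0, hence the separate requirement of finiteness almost everywhere. *)
definition ereal_L1_on :: "'a measure \<Rightarrow> 'a set \<Rightarrow> ('a \<Rightarrow> ereal) \<Rightarrow> bool" where
  "ereal_L1_on \<mu> S f \<longleftrightarrow>
     (AE x in \<mu>. x \<in> S \<longrightarrow> \<bar>f x\<bar> \<noteq> \<infinity>) \<and> set_integrable \<mu> S (\<lambda>x. real_of_ereal (f x))"

(* A family in the relaxed problem is a pair: the real-valued \<phi> i for i \<le> M, and the
   \<psi> i with values in the reals and -\<infinity> for i > M. Components of \<phi> and \<psi> at
   other indices, and values outside \<Omega> and K i, play no role. *)
definition relaxed_admissible ::
    "'a::euclidean_space set \<Rightarrow> nat \<Rightarrow> nat \<Rightarrow> real \<Rightarrow> (nat \<Rightarrow> real) \<Rightarrow> (nat \<Rightarrow> 'a measure) \<Rightarrow>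
       ((nat \<Rightarrow> 'a \<Rightarrow> real) \<times> (nat \<Rightarrow> 'a \<Rightarrow> ereal)) set" where
  "relaxed_admissible \<Omega> M N p w \<mu> = {(\<phi>, \<psi>).
     (\<forall>i\<in>{1..M}. convex_on \<Omega> (\<phi> i) \<and> continuous_on \<Omega> (\<phi> i)) \<and>
     (\<forall>i\<in>{M+1..N}. (\<forall>x\<in>supp_hull (\<mu> i). \<psi> i x \<noteq> \<infinity>) \<and>
        ereal_concave_on (supp_hull (\<mu> i)) (\<psi> i) \<and> usc_on (supp_hull (\<mu> i)) (\<psi> i) \<and>
        ereal_L1_on (\<mu> i) (supp_hull (\<mu> i)) (\<psi> i)) \<and>
     (\<forall>x \<in> PiE {1..N} (\<lambda>i. if i \<le> M then \<Omega> else supp_hull (\<mu> i)).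
        (\<Sum>i=1..M. ereal (\<phi> i (x i))) + (\<Sum>i=M+1..N. \<psi> i (x i)) \<le> ereal (cbar \<Omega> N p w x))}"

definition wDr ::
    "'a::euclidean_space set \<Rightarrow> nat \<Rightarrow> nat \<Rightarrow> real \<Rightarrow> (nat \<Rightarrow> real) \<Rightarrow> (nat \<Rightarrow> 'a measure) \<Rightarrow> ereal" where
  "wDr \<Omega> M N p w \<mu> =
     (SUP (\<phi>, \<psi>)\<in>relaxed_admissible \<Omega> M N p w \<mu>.
        ereal ((\<Sum>i=1..M. \<integral>x. \<phi> i x \<partial>\<mu> i) +
               (\<Sum>i=M+1..N. LINT x:supp_hull (\<mu> i)|\<mu> i. real_of_ereal (\<psi> i x))))"

definition open_simplex :: "nat \<Rightarrow> (nat \<Rightarrow> real) set" where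
  "open_simplex N = {w. (\<forall>i\<in>{1..N}. w i \<in> {0<..<1}) \<and> (\<Sum>i=1..N. w i) = 1}"

end

theory Submission
  imports Defs
begin

text \<open>
  Every dual family is in particular a relaxed dual family, with the same value, because each
  \<open>\<mu> i\<close> is carried by the convex hull of its support. The two remaining inequalities form a cycle
  with this one: the relaxed dual is bounded by every plan (\<open>wDr_le_wMM\<close>), and some plan costs no more
  than the unrelaxed dual (\<open>wMM_le_wD\<close>).

  For the first of these, the difficulty is that the convex order only speaks about finite convex
  functions on the whole space, whereas a relaxed potential is an upper semicontinuous concave
  function on a compact convex set, possibly with the value \<open>-\<infinity>\<close>. Such a function is the decreasing
  limit of its Lipschitz envelopes \<open>x \<mapsto> sup\<^sub>y (\<psi> y - n |x - y|)\<close>, which are finite and concave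
  everywhere (\<open>usc_concave_approximation\<close>). The envelopes can be integrated against the marginals of a
  plan. The limit would a priori need an integral of functions that take the value \<open>-\<infinity>\<close>; this is avoided
  by taking the maximum with the cost, which makes the sequence bounded and convergent to the cost
  itself. The envelope of the zero function on a convex set is minus the distance to that set; it
  shows that a measure below \<open>\<mu> i\<close> in convex order is carried by the convex hull of the support of
  \<open>\<mu> i\<close> (\<open>cx_le_concentrated\<close>).

  For the second, let \<open>v\<close> be the dual value. A plan of cost at most \<open>v\<close> is a probability measure on
  \<open>\<Omega>\<^sup>N\<close> whose integral is nonpositive on the convex cone of all functions
  \<open>a (c x - v) + (\<Sum>i. \<integral>\<Phi> i d\<mu> i - \<Phi> i (x i))\<close> with \<open>a \<ge> 0\<close> and continuous \<open>\<Phi> i\<close>, convex or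
  concave according to the index. By the definition of \<open>v\<close> no member of this cone has a positive lower
  bound (\<open>test_gap_not_positive\<close>); after rescaling, such a member would be a dual family of value
  larger than \<open>v\<close>. The Hahn-Banach theorem then yields a positive normalised linear functional that is
  nonpositive on the cone (\<open>positive_functional_nonpos_on_cone\<close>), and a Riesz representation theorem
  turns it into a measure. The representation is needed only on a Cantor cube, a product of two-point
  spaces, since \<open>\<Omega>\<^sup>N\<close> is a continuous image of one (\<open>compact_convex_cantor_image\<close>): the
  functional is taken on the cube from the start and the resulting measure is pushed forward. On the cube the
  indicators of clopen sets are continuous, so the functional gives their measure directly, and
  compactness makes this set function countably additive (\<open>cantor_riesz\<close>).
\<close>

section \<open>Positive functionals that are nonpositive on a cone\<close>

text \<open>With \<open>\<le>\<close> in the second clause, equality for \<open>a > 0\<close> follows by applying it to \<open>1 / a\<close> as well.\<close>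
definition sublinear :: "('v::real_vector \<Rightarrow> real) \<Rightarrow> bool" where
  "sublinear P \<longleftrightarrow> (\<forall>x y. P (x + y) \<le> P x + P y) \<and> (\<forall>a\<ge>0. \<forall>x. P (a *\<^sub>R x) \<le> a * P x)"

lemma sublinearD:
  assumes "sublinear P"
  shows "P (x + y) \<le> P x + P y" and "0 \<le> a \<Longrightarrow> P (a *\<^sub>R x) \<le> a * P x"
    and "P 0 = 0" and "- P (- x) \<le> P x"
proof -
  show add: "P (x + y) \<le> P x + P y" for x y
    using assms by (simp add: sublinear_def)
  show scale: "P (a *\<^sub>R x) \<le> a * P x" if "0 \<le> a" for a x
    using assms that by (simp add: sublinear_def)
  show 0: "P 0 = 0"
    using scale[of 0 0] add[of 0 0] by simp
  show "- P (- x) \<le> P x"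
    using add[of x "- x"] 0 by simp
qed

text \<open>The pointwise infimum exists because a sublinear \<open>p \<le> P\<close> is bounded below by \<open>- P (- x)\<close>. It is
  subadditive because two members of a chain can be replaced by the smaller of them. This is what Zorn's
  lemma needs.\<close>
lemma sublinear_chain_INF:
  assumes C: "C \<noteq> {}" "\<And>p. p \<in> C \<Longrightarrow> sublinear p \<and> p \<le> P"
    and chain: "\<And>p q. p \<in> C \<Longrightarrow> q \<in> C \<Longrightarrow> p \<le> q \<or> q \<le> p"
  shows "sublinear (\<lambda>x. INF p\<in>C. p x)" and "\<And>p. p \<in> C \<Longrightarrow> (\<lambda>x. INF p\<in>C. p x) \<le> p"
proof -
  have bdd: "bdd_below ((\<lambda>p. p x) ` C)" for x
  proof (rule bdd_belowI2)
    fix p assume "p \<in> C"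
    then have "sublinear p" "p (- x) \<le> P (- x)"
      using C(2) by (auto simp: le_fun_def)
    then show "- P (- x) \<le> p x"
      using sublinearD(4)[of p x] by linarith
  qed
  show le: "(\<lambda>x. INF p\<in>C. p x) \<le> p" if "p \<in> C" for p
    using bdd that by (auto simp: le_fun_def intro: cINF_lower)
  show "sublinear (\<lambda>x. INF p\<in>C. p x)"
    unfolding sublinear_def
  proof (intro conjI allI impI)
    fix x y
    have *: "(INF p\<in>C. p (x + y)) \<le> p x + q y" if pq: "p \<in> C" "q \<in> C" for p q
    proof -
      obtain r where r: "r \<in> C" "r \<le> p" "r \<le> q"
        using chain[OF pq] pq by blast
      have "(INF p\<in>C. p (x + y)) \<le> r (x + y)"
        using le[OF r(1)] by (simp add: le_fun_def)
      also have "\<dots> \<le> r x + r y"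
        using C(2)[OF r(1)] sublinearD(1) by blast
      finally show ?thesis
        using r(2,3) unfolding le_fun_def by (meson add_mono order_trans)
    qed
    have "(INF p\<in>C. p (x + y)) - p x \<le> (INF q\<in>C. q y)" if "p \<in> C" for p
      using *[OF that] C(1) by (intro cINF_greatest) (auto simp: algebra_simps)
    then have "(INF p\<in>C. p (x + y)) - (INF q\<in>C. q y) \<le> (INF p\<in>C. p x)"
      using C(1) by (intro cINF_greatest) (auto simp: algebra_simps)
    then show "(INF p\<in>C. p (x + y)) \<le> (INF p\<in>C. p x) + (INF p\<in>C. p y)"
      by simp
  next
    fix a :: real and x assume a: "0 \<le> a"
    have *: "(INF p\<in>C. p (a *\<^sub>R x)) \<le> a * p x" if "p \<in> C" for p
      using le[OF that] C(2)[OF that] sublinearD(2)[OF _ a, of p x]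
      by (meson le_fun_def order_trans)
    show "(INF p\<in>C. p (a *\<^sub>R x)) \<le> a * (INF p\<in>C. p x)"
    proof (cases "a = 0")
      case True
      then show ?thesis using * C(1) by auto
    next
      case False
      then have "(INF p\<in>C. p (a *\<^sub>R x)) / a \<le> (INF p\<in>C. p x)"
        using * a C(1) by (intro cINF_greatest) (auto simp: field_simps)
      then show ?thesis using False a by (simp add: field_simps)
    qed
  qed
qed

text \<open>For fixed \<open>y\<close>, lowering \<open>p\<close> as far as possible in the direction \<open>y\<close> gives the sublinear functional
  \<open>q x = inf {p (x + t y) - t p y | t \<ge> 0}\<close>. Minimality forces \<open>q = p\<close>, and \<open>t = 1\<close> at \<open>x = - y\<close> yields
  \<open>p (- y) \<le> - p y\<close>. A sublinear functional that is odd is linear.\<close>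
lemma minimal_sublinear_linear:
  assumes p: "sublinear p" and min: "\<And>q. sublinear q \<Longrightarrow> q \<le> p \<Longrightarrow> q = p"
  shows "linear p"
proof -
  have odd: "p (- y) = - p y" for y
  proof -
    define q where "q x = (INF t\<in>{0..}. p (x + t *\<^sub>R y) - t * p y)" for x
    have lower: "- p (- x) \<le> p (x + t *\<^sub>R y) - t * p y" if "0 \<le> t" for x t
    proof (cases "t = 0")
      case True then show ?thesis using sublinearD(4)[OF p] by simp
    next
      case False
      with that have t: "t > 0" by simp
      have "p y = p ((1/t) *\<^sub>R (t *\<^sub>R y))" using t by simp
      also have "\<dots> \<le> (1/t) * p (t *\<^sub>R y)" using t by (intro sublinearD(2)[OF p]) simp
      finally have "t * p y \<le> p (t *\<^sub>R y)" using t by (simp add: field_simps)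
      also have "\<dots> \<le> p (x + t *\<^sub>R y) + p (- x)"
        using sublinearD(1)[OF p, of "x + t *\<^sub>R y" "- x"] by simp
      finally show ?thesis by simp
    qed
    have le: "q x \<le> p (x + t *\<^sub>R y) - t * p y" if "0 \<le> t" for x t
      unfolding q_def using that lower by (intro cINF_lower bdd_belowI2[where m = "- p (- x)"]) auto
    have ge: "m \<le> q x" if "\<And>t. 0 \<le> t \<Longrightarrow> m \<le> p (x + t *\<^sub>R y) - t * p y" for m x
      unfolding q_def using that by (intro cINF_greatest) auto
    have "sublinear q"
      unfolding sublinear_def
    proof (intro conjI allI impI)
      fix u v
      have *: "q (u + v) \<le> (p (u + s *\<^sub>R y) - s * p y) + (p (v + t *\<^sub>R y) - t * p y)"
        if "0 \<le> s" "0 \<le> t" for s t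
      proof -
        have "q (u + v) \<le> p ((u + v) + (s + t) *\<^sub>R y) - (s + t) * p y"
          using that by (intro le) simp
        also have "p ((u + v) + (s + t) *\<^sub>R y) \<le> p (u + s *\<^sub>R y) + p (v + t *\<^sub>R y)"
          using sublinearD(1)[OF p, of "u + s *\<^sub>R y" "v + t *\<^sub>R y"] by (simp add: algebra_simps)
        finally show ?thesis by (simp add: algebra_simps)
      qed
      have "q (u + v) - (p (u + s *\<^sub>R y) - s * p y) \<le> q v" if "0 \<le> s" for s
        using *[OF that] by (intro ge) (simp add: algebra_simps)
      then have "q (u + v) - q v \<le> q u"
        by (intro ge) (simp add: algebra_simps)
      then show "q (u + v) \<le> q u + q v" by simp
    next
      fix a :: real and u assume a: "0 \<le> a"
      show "q (a *\<^sub>R u) \<le> a * q u"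
      proof (cases "a = 0")
        case True
        then show ?thesis using le[of 0 0] sublinearD(3)[OF p] by simp
      next
        case False
        have "q (a *\<^sub>R u) / a \<le> p (u + t *\<^sub>R y) - t * p y" if "0 \<le> t" for t
        proof -
          have "q (a *\<^sub>R u) \<le> p (a *\<^sub>R u + (a * t) *\<^sub>R y) - (a * t) * p y"
            using a that by (intro le) simp
          also have "p (a *\<^sub>R u + (a * t) *\<^sub>R y) \<le> a * p (u + t *\<^sub>R y)"
            using sublinearD(2)[OF p a, of "u + t *\<^sub>R y"] by (simp add: scaleR_right_distrib)
          finally show ?thesis using a False by (simp add: field_simps)
        qed
        then have "q (a *\<^sub>R u) / a \<le> q u" by (rule ge)
        then show ?thesis using a False by (simp add: field_simps)
      qed
    qed
    moreover have "q \<le> p"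
      using le[of 0] by (auto simp: le_fun_def)
    ultimately have "q = p" by (rule min)
    then have "p (- y) \<le> - p y"
      using le[of 1 "- y"] sublinearD(3)[OF p] by simp
    then show ?thesis using sublinearD(4)[OF p, of y] by simp
  qed
  show ?thesis
  proof
    fix x y
    have "p (- (x + y)) \<le> p (- x) + p (- y)"
      using sublinearD(1)[OF p, of "- x" "- y"] by simp
    then show "p (x + y) = p x + p y"
      using sublinearD(1)[OF p, of x y] odd[of "x + y"] odd[of x] odd[of y] by simp
  next
    fix a :: real and x
    have pos: "p (b *\<^sub>R x) = b * p x" if "0 \<le> b" for b
      using sublinearD(2)[OF p that, of x] sublinearD(2)[OF p that, of "- x"] odd[of x] odd[of "b *\<^sub>R x"]
      by simp
    show "p (a *\<^sub>R x) = a *\<^sub>R p x"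
      using pos[of a] pos[of "- a"] odd[of "a *\<^sub>R x"] by (cases "0 \<le> a") auto
  qed
qed

text \<open>The Hahn-Banach theorem for sublinear functionals: by Zorn's lemma there is a minimal one below
  \<open>P\<close>, and minimal ones are linear.\<close>
lemma linear_below_sublinear:
  assumes "sublinear P"
  obtains L where "linear L" "\<And>x. L x \<le> P x"
proof -
  let ?A = "{p. sublinear p \<and> p \<le> P}"
  have po: "partial_order_on ?A (relation_of (\<ge>) ?A)"
    by (rule partial_order_on_relation_ofI) auto
  have "\<exists>m\<in>?A. \<forall>a\<in>?A. m \<ge> a \<longrightarrow> a = m"
  proof (rule predicate_Zorn[OF po])
    fix C assume "C \<in> Chains (relation_of (\<ge>) ?A)"
    then have C: "\<And>p. p \<in> C \<Longrightarrow> sublinear p \<and> p \<le> P"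
      and chain: "\<And>p q. p \<in> C \<Longrightarrow> q \<in> C \<Longrightarrow> p \<le> q \<or> q \<le> p"
      by (auto simp: Chains_def relation_of_def)
    show "\<exists>u\<in>?A. \<forall>a\<in>C. a \<ge> u"
    proof (cases "C = {}")
      case True then show ?thesis using assms by auto
    next
      case False
      note I = sublinear_chain_INF[OF False C chain]
      obtain p where "p \<in> C" using False by blast
      then have "(\<lambda>x. INF p\<in>C. p x) \<le> P"
        using I(2) C order_trans by blast
      then show ?thesis using I by blast
    qed
  qed
  then obtain m where m: "sublinear m" "m \<le> P" "\<And>a. sublinear a \<Longrightarrow> a \<le> P \<Longrightarrow> a \<le> m \<Longrightarrow> a = m"
    by blast
  then have "linear m"
    by (intro minimal_sublinear_linear) (auto intro: order_trans)
  then show ?thesis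
    using that m(2) by (auto simp: le_fun_def)
qed

text \<open>A functional as desired satisfies \<open>L f \<le> L (f - g) \<le> sup (f - g)\<close> for all \<open>g\<close> in the cone, so it must
  lie below \<open>P f = inf {sup (f - g) | g \<in> C}\<close>. Conversely any linear functional below \<open>P\<close> works, and the
  hypothesis on \<open>C\<close> says precisely that \<open>P\<close> is finite. The bound \<open>L f \<le> t\<close> for \<open>f \<le> t\<close> expresses both
  positivity and normalisation.\<close>
lemma positive_functional_nonpos_on_cone:
  fixes C :: "('x::topological_space \<Rightarrow>\<^sub>C real) set"
  assumes zero: "0 \<in> C" and add: "\<And>g h. g \<in> C \<Longrightarrow> h \<in> C \<Longrightarrow> g + h \<in> C"
    and scale: "\<And>a g. 0 \<le> a \<Longrightarrow> g \<in> C \<Longrightarrow> a *\<^sub>R g \<in> C"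
    and nonpos: "\<And>g \<delta>. g \<in> C \<Longrightarrow> 0 < \<delta> \<Longrightarrow> \<exists>x. apply_bcontfun g x < \<delta>"
  obtains L :: "('x \<Rightarrow>\<^sub>C real) \<Rightarrow> real" where "linear L"
    "\<And>f t. (\<And>x. apply_bcontfun f x \<le> t) \<Longrightarrow> L f \<le> t" "\<And>g. g \<in> C \<Longrightarrow> L g \<le> 0"
proof -
  define T where "T f = {t. \<exists>g\<in>C. \<forall>x. apply_bcontfun f x - apply_bcontfun g x \<le> t}" for f
  define P where "P f = Inf (T f)" for f
  have bound: "\<bar>apply_bcontfun f x\<bar> \<le> norm f" for f :: "'x \<Rightarrow>\<^sub>C real" and x
    using norm_bounded[of f x] by simp
  have lower: "- norm f \<le> t" if t: "t \<in> T f" for f t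
  proof (rule ccontr)
    assume "\<not> - norm f \<le> t"
    then have "0 < - norm f - t" by simp
    moreover obtain g where g: "g \<in> C" "\<And>x. apply_bcontfun f x - apply_bcontfun g x \<le> t"
      using t by (auto simp: T_def)
    ultimately obtain x where "apply_bcontfun g x < - norm f - t" using nonpos by blast
    then show False using g(2)[of x] bound[of f x] by linarith
  qed
  then have bdd: "bdd_below (T f)" for f by (rule bdd_belowI)
  have mem: "t \<in> T f" if "\<And>x. apply_bcontfun f x \<le> t" for f t
    unfolding T_def using zero that by (auto intro!: bexI[of _ 0])
  have nonempty: "T f \<noteq> {}" for f
    using mem[of f "norm f"] bound[of f] by (metis abs_le_D1 empty_iff)
  have P_le: "P f \<le> t" if "t \<in> T f" for f t
    unfolding P_def using that bdd by (rule cInf_lower)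
  have P_ge: "m \<le> P f" if "\<And>t. t \<in> T f \<Longrightarrow> m \<le> t" for f m
    unfolding P_def using nonempty that by (rule cInf_greatest)
  have "sublinear P"
    unfolding sublinear_def
  proof (intro conjI allI impI)
    fix f h
    have *: "P (f + h) \<le> s + t" if "s \<in> T f" "t \<in> T h" for s t
    proof (rule P_le)
      obtain g k where gk: "g \<in> C" "\<And>x. apply_bcontfun f x - apply_bcontfun g x \<le> s"
        "k \<in> C" "\<And>x. apply_bcontfun h x - apply_bcontfun k x \<le> t"
        using \<open>s \<in> T f\<close> \<open>t \<in> T h\<close> by (auto simp: T_def)
      have "apply_bcontfun (f + h) x - apply_bcontfun (g + k) x \<le> s + t" for x
        using gk(2)[of x] gk(4)[of x] by simp
      then show "s + t \<in> T (f + h)" unfolding T_def using add gk(1,3) by blast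
    qed
    have "P (f + h) - s \<le> P h" if "s \<in> T f" for s
      using *[OF that] by (intro P_ge) (simp add: algebra_simps)
    then have "P (f + h) - P h \<le> P f" by (intro P_ge) (simp add: algebra_simps)
    then show "P (f + h) \<le> P f + P h" by simp
  next
    fix a :: real and f assume a: "0 \<le> a"
    have *: "P (a *\<^sub>R f) \<le> a * t" if t: "t \<in> T f" for t
    proof (rule P_le)
      obtain g where g: "g \<in> C" "\<And>x. apply_bcontfun f x - apply_bcontfun g x \<le> t"
        using t by (auto simp: T_def)
      have "apply_bcontfun (a *\<^sub>R f) x - apply_bcontfun (a *\<^sub>R g) x \<le> a * t" for x
        using mult_left_mono[OF g(2) a, of x] by (simp add: algebra_simps)
      then show "a * t \<in> T (a *\<^sub>R f)" unfolding T_def using scale[OF a g(1)] by blast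
    qed
    show "P (a *\<^sub>R f) \<le> a * P f"
    proof (cases "a = 0")
      case True
      then show ?thesis using mem[of 0 0] P_le[of 0 0] by simp
    next
      case False
      then have "P (a *\<^sub>R f) / a \<le> P f" using * a by (intro P_ge) (simp add: field_simps)
      then show ?thesis using False a by (simp add: field_simps)
    qed
  qed
  then obtain L where L: "linear L" "\<And>f. L f \<le> P f"
    by (rule linear_below_sublinear) blast
  show ?thesis
  proof
    show "linear L" by fact
    show "L f \<le> t" if "\<And>x. apply_bcontfun f x \<le> t" for f t
      using L(2)[of f] P_le[OF mem[OF that]] by linarith
    show "L g \<le> 0" if "g \<in> C" for g
    proof -
      have "0 \<in> T g" unfolding T_def using that by (auto intro!: bexI[of _ g])
      then show ?thesis using L(2)[of g] P_le by fastforce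
    qed
  qed
qed

section \<open>Measures on Cantor cubes\<close>

lemma compact_cantor: "compact (UNIV :: ('i \<Rightarrow> bool) set)"
proof -
  have "compact_space (euclidean :: bool topology)"
    by (simp add: compact_space_def finite_imp_compact)
  then have "compact_space (product_topology (\<lambda>_::'i. euclidean :: bool topology) UNIV)"
    by (simp add: compact_space_product_topology)
  then show ?thesis
    by (simp add: euclidean_product_topology compact_space_def)
qed

lemma cantor_clopen_neighbourhood:
  fixes x :: "'i \<Rightarrow> bool"
  assumes "open U" "x \<in> U"
  obtains A where "open A" "closed A" "x \<in> A" "A \<subseteq> U"
proof -
  have "openin (product_topology (\<lambda>_::'i. euclidean :: bool topology) UNIV) U"
    using assms by (simp add: euclidean_product_topology)
  from product_topology_open_contains_basis[OF this \<open>x \<in> U\<close>]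
  obtain X where X: "x \<in> (\<Pi>\<^sub>E i\<in>UNIV. X i)" "finite {i. X i \<noteq> UNIV}" "(\<Pi>\<^sub>E i\<in>UNIV. X i) \<subseteq> U"
    by auto
  show ?thesis
  proof
    show "open (\<Pi>\<^sub>E i\<in>UNIV. X i)"
      using X(2) by (intro open_PiE) (simp_all add: Topological_Spaces.open_discrete)
    have "- (\<Pi>\<^sub>E i\<in>UNIV. X i) = (\<Union>i. (\<lambda>x. x i) -` (- X i))"
      by (auto simp: PiE_def)
    also have "open \<dots>"
      by (intro open_UN ballI open_vimage[OF Topological_Spaces.open_discrete continuous_on_product_coordinates])
    finally show "closed (\<Pi>\<^sub>E i\<in>UNIV. X i)"
      by (simp add: closed_def)
  qed (use X in auto)
qed

text \<open>Clopen sets allow continuous functions to be glued without any matching condition; this is the reason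
  for working on a zero-dimensional space.\<close>
lemma continuous_on_if_clopen:
  fixes f g :: "'a::topological_space \<Rightarrow> 'b::topological_space"
  assumes "open A" "closed A" "continuous_on UNIV f" "continuous_on UNIV g"
  shows "continuous_on UNIV (\<lambda>x. if x \<in> A then f x else g x)"
proof -
  have "continuous_on (A \<union> - A) (\<lambda>x. if x \<in> A then f x else g x)"
    using assms by (intro continuous_on_cases) (auto intro: continuous_on_subset)
  then show ?thesis by simp
qed

text \<open>Each point has a clopen neighbourhood on which \<open>f\<close> is almost constant. By compactness finitely many of
  them cover the space, and the constants are glued one neighbourhood at a time.\<close>
lemma cantor_finite_range_approximation:
  fixes f :: "('i \<Rightarrow> bool) \<Rightarrow> real"
  assumes f: "continuous_on UNIV f" and "0 < \<epsilon>"
  obtains g where "continuous_on UNIV g" "finite (range g)" "\<And>x. \<bar>f x - g x\<bar> < \<epsilon>"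
proof -
  have "\<exists>A. open A \<and> closed A \<and> x \<in> A \<and> A \<subseteq> f -` ball (f x) \<epsilon>" for x
    by (rule cantor_clopen_neighbourhood[of "f -` ball (f x) \<epsilon>" x])
       (use f \<open>0 < \<epsilon>\<close> in \<open>auto intro: open_vimage\<close>)
  then obtain A where A: "\<And>x. open (A x)" "\<And>x. closed (A x)" "\<And>x. x \<in> A x"
    "\<And>x. A x \<subseteq> f -` ball (f x) \<epsilon>"
    by metis
  obtain I where I: "finite I" "UNIV \<subseteq> (\<Union>x\<in>I. A x)"
    by (rule compactE_image[OF compact_cantor, of UNIV A]) (use A in auto)
  have "\<exists>g. continuous_on UNIV g \<and> finite (range g) \<and> (\<forall>x\<in>(\<Union>x\<in>I. A x). \<bar>f x - g x\<bar> < \<epsilon>)"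
    using I(1)
  proof (induction I)
    case empty
    show ?case by (intro exI[of _ "\<lambda>_. 0"]) auto
  next
    case (insert y I)
    then obtain g where g: "continuous_on UNIV g" "finite (range g)"
      "\<forall>x\<in>(\<Union>x\<in>I. A x). \<bar>f x - g x\<bar> < \<epsilon>" by blast
    let ?h = "\<lambda>x. if x \<in> A y then f y else g x"
    have "continuous_on UNIV ?h"
      using A g by (intro continuous_on_if_clopen) auto
    moreover have "finite (range ?h)"
    proof (rule finite_subset)
      show "range ?h \<subseteq> insert (f y) (range g)" by auto
      show "finite (insert (f y) (range g))" using g(2) by simp
    qed
    moreover have "\<bar>f x - f y\<bar> < \<epsilon>" if "x \<in> A y" for x
      using that A(4)[of y] by (auto simp: dist_real_def)
    then have "\<bar>f x - ?h x\<bar> < \<epsilon>" if "x \<in> (\<Union>x\<in>insert y I. A x)" for x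
      using that g(3) by (cases "x \<in> A y") auto
    ultimately show ?case by (intro exI[of _ ?h]) blast
  qed
  then obtain g where g: "continuous_on UNIV g" "finite (range g)" "\<forall>x\<in>(\<Union>x\<in>I. A x). \<bar>f x - g x\<bar> < \<epsilon>"
    by blast
  have "\<bar>f x - g x\<bar> < \<epsilon>" for x
  proof -
    have "x \<in> (\<Union>x\<in>I. A x)" using I(2) by blast
    with g(3) show ?thesis by (rule bspec)
  qed
  with g(1,2) show ?thesis by (rule that)
qed

lemma finite_range_vimage_clopen:
  fixes g :: "'a::topological_space \<Rightarrow> real"
  assumes "continuous_on UNIV g" "finite (range g)"
  shows "open (g -` B)" "closed (g -` B)"
proof -
  have *: "closed (g -` B)" for B
  proof -
    have "g -` B = g -` (B \<inter> range g)" by auto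
    also have "closed \<dots>"
      using assms by (intro closed_vimage finite_imp_closed) auto
    finally show ?thesis .
  qed
  show "closed (g -` B)" by (rule *)
  show "open (g -` B)" using *[of "- B"] by (simp add: closed_def vimage_Compl)
qed

text \<open>The Riesz representation theorem on a Cantor cube. The indicator \<open>chi A\<close> of a clopen set is a continuous
  function, so \<open>L (chi A)\<close> defines a finitely additive set function on the algebra of clopen sets. A decreasing
  sequence of clopen sets with empty intersection is eventually empty by compactness, hence
  Caratheodory's theorem applies. Integral and functional agree on continuous functions with finite range
  and therefore, by uniform approximation, on all continuous functions. Measurability is asserted for real
  continuous functions only: for an uncountable index type the clopen sets need not generate the Borel
  sigma-algebra.\<close>
lemma cantor_riesz:
  fixes L :: "(('i \<Rightarrow> bool) \<Rightarrow>\<^sub>C real) \<Rightarrow> real"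
  assumes "linear L" and upper: "\<And>f t. (\<And>x. apply_bcontfun f x \<le> t) \<Longrightarrow> L f \<le> t"
  obtains m where "prob_space m" "space m = UNIV"
    "\<And>f :: ('i \<Rightarrow> bool) \<Rightarrow> real. continuous_on UNIV f \<Longrightarrow> f \<in> borel_measurable m"
    "\<And>f. (\<integral>x. apply_bcontfun f x \<partial>m) = L f"
proof -
  interpret L: linear L by fact
  define CO where "CO = {A :: ('i \<Rightarrow> bool) set. open A \<and> closed A}"
  define chi :: "('i \<Rightarrow> bool) set \<Rightarrow> ('i \<Rightarrow> bool) \<Rightarrow>\<^sub>C real"
    where "chi A = Bcontfun (indicator A)" for A
  have chi: "apply_bcontfun (chi A) = indicator A" if "A \<in> CO" for A
    unfolding chi_def
  proof (rule Bcontfun_inverse)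
    have "continuous_on UNIV (\<lambda>x. if x \<in> A then 1 else 0 :: real)"
      using that by (intro continuous_on_if_clopen) (auto simp: CO_def)
    moreover have "bounded (range (indicator A :: _ \<Rightarrow> real))"
    proof (rule finite_imp_bounded, rule finite_subset)
      show "range (indicator A) \<subseteq> {0, 1 :: real}" by (auto simp: indicator_def)
    qed simp
    ultimately show "(indicator A :: _ \<Rightarrow> real) \<in> bcontfun"
      unfolding bcontfun_def indicator_def of_bool_def by blast
  qed
  have lower: "t \<le> L f" if "\<And>x. t \<le> apply_bcontfun f x" for f t
    using upper[of "- f" "- t"] that by (simp add: L.neg)
  define \<mu>0 where "\<mu>0 A = ennreal (L (chi A))" for A
  have chi_nonneg: "0 \<le> L (chi A)" if "A \<in> CO" for A
    using that by (intro lower) (simp add: chi)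
  interpret algebra UNIV CO
    unfolding algebra_iff_Un by (auto simp: CO_def)
  have chi_empty: "chi {} = 0"
    by (rule bcontfun_eqI) (simp add: chi empty_sets)
  have "\<exists>m. (\<forall>A\<in>CO. m A = \<mu>0 A) \<and> measure_space UNIV (sigma_sets UNIV CO) m"
  proof (rule caratheodory_empty_continuous)
    show "positive CO \<mu>0"
      by (simp add: positive_def \<mu>0_def chi_empty L.zero)
    show "additive CO \<mu>0"
      unfolding additive_def
    proof (intro ballI impI)
      fix A B assume AB: "A \<in> CO" "B \<in> CO" "A \<inter> B = {}"
      have "chi (A \<union> B) = chi A + chi B"
        using AB by (intro bcontfun_eqI) (auto simp: chi Un indicator_def)
      then show "\<mu>0 (A \<union> B) = \<mu>0 A + \<mu>0 B"
        using AB chi_nonneg by (simp add: \<mu>0_def L.add ennreal_plus)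
    qed
    show "\<mu>0 A \<noteq> \<infinity>" for A by (simp add: \<mu>0_def)
    fix A :: "nat \<Rightarrow> ('i \<Rightarrow> bool) set"
    assume A: "range A \<subseteq> CO" "decseq A" "(\<Inter>i. A i) = {}"
    have "closed (A i)" for i using A(1) by (auto simp: CO_def)
    moreover have "UNIV \<subseteq> (\<Union>i. - A i)" using A(3) by auto
    ultimately obtain J where J: "finite J" "UNIV \<subseteq> (\<Union>i\<in>J. - A i)"
      by (rule compactE_image[OF compact_cantor, of UNIV "\<lambda>i. - A i", OF open_Compl]) blast
    have "A n = {}" if n: "Max (insert 0 J) \<le> n" for n
    proof -
      have "A n \<subseteq> A i" if "i \<in> J" for i
      proof -
        have "i \<le> Max (insert 0 J)" using J(1) that by (intro Max_ge) auto
        then show ?thesis using n by (intro decseqD[OF A(2)]) linarith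
      qed
      then show ?thesis using J(2) by blast
    qed
    then have "\<forall>\<^sub>F n in sequentially. \<mu>0 (A n) = 0"
      unfolding eventually_sequentially
      by (intro exI[of _ "Max (insert 0 J)"]) (auto simp: \<mu>0_def chi_empty L.zero)
    then show "(\<lambda>i. \<mu>0 (A i)) \<longlonglongrightarrow> 0"
      by (rule tendsto_eventually)
  qed
  then obtain m' where m': "\<And>A. A \<in> CO \<Longrightarrow> m' A = \<mu>0 A" "measure_space UNIV (sigma_sets UNIV CO) m'"
    by blast
  define m where "m = measure_of UNIV (sigma_sets UNIV CO) m'"
  have space: "space m = UNIV" and sets: "sets m = sigma_sets UNIV CO"
    by (simp_all add: m_def sigma_sets_sigma_sets_eq)
  have em: "emeasure m A = ennreal (L (chi A))" if "A \<in> CO" for A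
    using that m' unfolding m_def measure_space_def
    by (subst emeasure_measure_of_sigma) (auto simp: \<mu>0_def sigma_sets.Basic)
  have CO_sets: "A \<in> sets m" if "A \<in> CO" for A
    using that by (simp add: sets sigma_sets.Basic)
  have "chi UNIV = const_bcontfun 1"
    by (rule bcontfun_eqI) (simp add: chi top const_bcontfun.rep_eq)
  then have "L (chi UNIV) = 1"
    using upper[of "chi UNIV" 1] lower[of 1 "chi UNIV"] by (simp add: const_bcontfun.rep_eq)
  then have m: "prob_space m"
    by (intro prob_spaceI) (simp add: space em top)
  interpret m: prob_space m by fact
  have simple_measurable: "g \<in> borel_measurable m"
    if g: "continuous_on UNIV g" "finite (range g)" for g :: "('i \<Rightarrow> bool) \<Rightarrow> real"
    using finite_range_vimage_clopen[OF g] by (intro measurableI CO_sets) (auto simp: space CO_def)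
  have measurable: "f \<in> borel_measurable m" if f: "continuous_on UNIV f" for f :: "('i \<Rightarrow> bool) \<Rightarrow> real"
  proof -
    have "\<exists>g. continuous_on UNIV g \<and> finite (range g) \<and> (\<forall>x. \<bar>f x - g x\<bar> < inverse (real (Suc n)))" for n
      by (rule cantor_finite_range_approximation[OF f, of "inverse (real (Suc n))"]) auto
    then obtain g where g: "\<And>n. continuous_on UNIV (g n)" "\<And>n. finite (range (g n))"
      "\<And>n x. \<bar>f x - g n x\<bar> < inverse (real (Suc n))" by metis
    have "(\<lambda>n. g n x) \<longlonglongrightarrow> f x" for x
    proof (rule LIMSEQ_I)
      fix r :: real assume "0 < r"
      then obtain n0 where n0: "inverse (real (Suc n0)) < r" using reals_Archimedean by blast
      have "norm (g n x - f x) < r" if "n0 \<le> n" for n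
      proof -
        have "inverse (real (Suc n)) \<le> inverse (real (Suc n0))"
          using that by (intro le_imp_inverse_le) auto
        then have "\<bar>f x - g n x\<bar> < r" using g(3)[of x n] n0 by linarith
        then show ?thesis by (simp add: abs_minus_commute)
      qed
      then show "\<exists>no. \<forall>n\<ge>no. norm (g n x - f x) < r" by blast
    qed
    then show ?thesis
      using simple_measurable[OF g(1,2)] by (intro borel_measurable_LIMSEQ_real[of m g f]) auto
  qed
  have simple_integral: "(\<integral>x. apply_bcontfun g x \<partial>m) = L g" if g: "finite (range (apply_bcontfun g))" for g
  proof -
    let ?R = "range (apply_bcontfun g)" and ?A = "\<lambda>a. apply_bcontfun g -` {a}"
    have A: "?A a \<in> CO" for a
      using finite_range_vimage_clopen[of "apply_bcontfun g" "{a}"] g by (simp add: CO_def)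
    have eq: "apply_bcontfun g x = (\<Sum>a\<in>?R. a * indicator (?A a) x)" for x
      using g by (subst sum.mono_neutral_right[of _ "{apply_bcontfun g x}"]) (auto simp: indicator_def)
    have sum_apply: "apply_bcontfun (\<Sum>a\<in>S. h a) x = (\<Sum>a\<in>S. apply_bcontfun (h a) x)"
      if "finite S" for S x and h :: "real \<Rightarrow> ('i \<Rightarrow> bool) \<Rightarrow>\<^sub>C real"
      using that by (induction S) auto
    have "g = (\<Sum>a\<in>?R. a *\<^sub>R chi (?A a))"
    proof (rule bcontfun_eqI)
      fix x
      have "apply_bcontfun (\<Sum>a\<in>?R. a *\<^sub>R chi (?A a)) x = (\<Sum>a\<in>?R. a * indicator (?A a) x)"
        using g A by (simp add: sum_apply chi)
      then show "apply_bcontfun g x = apply_bcontfun (\<Sum>a\<in>?R. a *\<^sub>R chi (?A a)) x"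
        by (rule trans[OF eq sym])
    qed
    from arg_cong[OF this, of L] have "L g = (\<Sum>a\<in>?R. a * L (chi (?A a)))"
      by (simp only: L.sum L.scale real_scaleR_def)
    also have "\<dots> = (\<Sum>a\<in>?R. a * measure m (?A a))"
      using A chi_nonneg by (simp add: measure_def em)
    also have "\<dots> = (\<integral>x. (\<Sum>a\<in>?R. a * indicator (?A a) x) \<partial>m)"
    proof -
      have [measurable]: "?A a \<in> sets m" for a using A CO_sets by blast
      have "integrable m (indicat_real (?A a))" for a
        by (intro m.integrable_const_bound[of _ 1]) (auto simp: indicator_def)
      then show ?thesis
        by (subst Bochner_Integration.integral_sum) (auto simp: space)
    qed
    also have "\<dots> = (\<integral>x. apply_bcontfun g x \<partial>m)"
      by (simp only: eq[symmetric])
    finally show ?thesis by simp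
  qed
  have bint: "integrable m (apply_bcontfun f)" for f :: "('i \<Rightarrow> bool) \<Rightarrow>\<^sub>C real"
    using norm_bounded[of f] by (intro m.integrable_const_bound[of _ "norm f"] measurable) auto
  have integral: "(\<integral>x. apply_bcontfun f x \<partial>m) = L f" for f
  proof -
    have "\<bar>(\<integral>x. apply_bcontfun f x \<partial>m) - L f\<bar> \<le> \<epsilon>" if \<epsilon>: "0 < \<epsilon>" for \<epsilon>
    proof -
      obtain g0 where g0: "continuous_on UNIV g0" "finite (range g0)"
        "\<And>x. \<bar>apply_bcontfun f x - g0 x\<bar> < \<epsilon>/2"
        by (rule cantor_finite_range_approximation[of "apply_bcontfun f" "\<epsilon>/2"]) (use \<epsilon> in auto)
      then have "g0 \<in> bcontfun" by (auto simp: bcontfun_def intro: finite_imp_bounded)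
      then obtain g where g: "g0 = apply_bcontfun g" by (rule bcontfunE)
      have le: "apply_bcontfun (f - g) x \<le> \<epsilon>/2" "- (\<epsilon>/2) \<le> apply_bcontfun (f - g) x" for x
      proof -
        have "apply_bcontfun (f - g) x = apply_bcontfun f x - g0 x" by (simp add: g)
        then show "apply_bcontfun (f - g) x \<le> \<epsilon>/2" "- (\<epsilon>/2) \<le> apply_bcontfun (f - g) x"
          using g0(3)[of x] by linarith+
      qed
      have "L (f - g) \<le> \<epsilon>/2" "- (\<epsilon>/2) \<le> L (f - g)"
        by (rule upper, rule le) (rule lower, rule le)
      moreover have "(\<integral>x. apply_bcontfun (f - g) x \<partial>m) \<le> \<epsilon>/2"
        by (intro m.integral_le_const bint always_eventually allI le)
      moreover have "- (\<epsilon>/2) \<le> (\<integral>x. apply_bcontfun (f - g) x \<partial>m)"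
        by (intro m.integral_ge_const bint always_eventually allI le)
      moreover have "(\<integral>x. apply_bcontfun (f - g) x \<partial>m) = (\<integral>x. apply_bcontfun f x \<partial>m) - L g"
        using bint simple_integral[of g] g0(2) by (simp add: g)
      ultimately show ?thesis by (auto simp: L.diff abs_le_iff)
    qed
    then have "\<bar>(\<integral>x. apply_bcontfun f x \<partial>m) - L f\<bar> \<le> 0"
      by (rule field_le_epsilon) simp
    then show ?thesis by simp
  qed
  show ?thesis by (rule that[OF m space measurable integral])
qed

definition binary_value :: "(nat \<Rightarrow> bool) \<Rightarrow> real" where
  "binary_value b = (\<Sum>k. of_bool (b k) * (1/2) ^ Suc k)"

lemma continuous_on_binary_value: "continuous_on UNIV binary_value"
proof -
  have "uniform_limit UNIV (\<lambda>n b. \<Sum>k<n. of_bool (b k) * (1/2) ^ Suc k) binary_value sequentially"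
    unfolding binary_value_def
  proof (rule Weierstrass_m_test)
    show "summable (\<lambda>k. (1/2 :: real) ^ Suc k)"
      by (simp add: summable_geometric)
  qed auto
  moreover have "continuous_on UNIV (\<lambda>b::nat \<Rightarrow> bool. \<Sum>k<n. of_bool (b k) * (1/2 :: real) ^ Suc k)" for n
  proof (intro continuous_intros)
    fix k
    have "continuous_on UNIV (of_bool :: bool \<Rightarrow> real)" by (rule Topological_Spaces.continuous_on_discrete)
    then show "continuous_on UNIV (\<lambda>b::nat \<Rightarrow> bool. of_bool (b k) :: real)"
      by (rule continuous_on_compose2[OF _ continuous_on_product_coordinates]) simp
  qed
  ultimately show ?thesis
    by (intro uniform_limit_theorem) auto
qed

text \<open>Greedy binary expansion: \<open>r n\<close> is the rescaled remainder after \<open>n\<close> digits and stays in the unit interval.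
  The digit is 1 as soon as \<open>r n \<ge> 1/2\<close>, so the value 1 is reached as well, with all digits 1.\<close>
lemma binary_value_surj:
  assumes "0 \<le> x" "x \<le> 1"
  obtains b where "binary_value b = x"
proof -
  define r where "r = rec_nat x (\<lambda>_ y. 2 * y - of_bool (1/2 \<le> y))"
  have r: "r 0 = x" "\<And>n. r (Suc n) = 2 * r n - of_bool (1/2 \<le> r n)"
    by (simp_all add: r_def)
  have bound: "0 \<le> r n \<and> r n \<le> 1" for n
    by (induction n) (use assms r in auto)
  have partial: "(\<Sum>k<n. of_bool (1/2 \<le> r k) * (1/2) ^ Suc k) = x - r n * (1/2) ^ n" for n
    by (induction n) (simp_all add: r field_simps)
  have "(\<lambda>n. r n * (1/2) ^ n) \<longlonglongrightarrow> 0"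
  proof (rule Lim_null_comparison)
    show "(\<lambda>n. (1/2 :: real) ^ n) \<longlonglongrightarrow> 0" by (intro LIMSEQ_realpow_zero) auto
    show "\<forall>\<^sub>F n in sequentially. norm (r n * (1/2) ^ n) \<le> (1/2) ^ n"
      using bound by (auto simp: abs_mult intro!: always_eventually mult_left_le_one_le)
  qed
  then have "(\<lambda>n. x - r n * (1/2) ^ n) \<longlonglongrightarrow> x - 0"
    by (intro tendsto_intros)
  then have "(\<lambda>k. of_bool (1/2 \<le> r k) * (1/2) ^ Suc k) sums x"
    unfolding sums_def partial by simp
  then have "binary_value (\<lambda>k. 1/2 \<le> r k) = x"
    unfolding binary_value_def by (simp add: sums_iff)
  then show ?thesis by (rule that)
qed

text \<open>Binary expansions of the coordinates map the cube onto a box around \<open>\<Omega>\<close>, and the nearest-point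
  projection, which is continuous because \<open>\<Omega>\<close> is convex, retracts the box onto \<open>\<Omega>\<close>.\<close>
lemma compact_convex_cantor_image:
  fixes \<Omega> :: "'a::euclidean_space set"
  assumes "compact \<Omega>" "convex \<Omega>" "\<Omega> \<noteq> {}"
  obtains D :: "('a \<times> nat \<Rightarrow> bool) \<Rightarrow> 'a" where "continuous_on UNIV D" "range D = \<Omega>"
proof -
  obtain B where B: "0 < B" "\<And>x. x \<in> \<Omega> \<Longrightarrow> norm x \<le> B"
    using compact_imp_bounded[OF assms(1)] bounded_pos by blast
  define E :: "('a \<times> nat \<Rightarrow> bool) \<Rightarrow> 'a"
    where "E b = (\<Sum>e\<in>Basis. (B * (2 * binary_value (\<lambda>k. b (e, k)) - 1)) *\<^sub>R e)" for b
  have closed: "closed \<Omega>" using assms(1) by (rule compact_imp_closed)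
  have cont: "continuous_on UNIV E"
    unfolding E_def
  proof (intro continuous_intros)
    fix e :: 'a
    have "continuous_on UNIV (\<lambda>(b :: 'a \<times> nat \<Rightarrow> bool) k. b (e, k))"
      by (intro continuous_on_coordinatewise_then_product continuous_on_product_coordinates)
    then show "continuous_on UNIV (\<lambda>b. binary_value (\<lambda>k. b (e, k)))"
      using continuous_on_compose2[OF continuous_on_binary_value] by blast
  qed
  have surj: "\<exists>b. E b = x" if "x \<in> \<Omega>" for x
  proof -
    have "\<exists>c. B * (2 * binary_value c - 1) = x \<bullet> e" if e: "e \<in> Basis" for e
    proof -
      have "\<bar>x \<bullet> e\<bar> \<le> B" using Basis_le_norm[OF e, of x] B(2)[OF \<open>x \<in> \<Omega>\<close>] by linarith
      then have "0 \<le> (x \<bullet> e / B + 1) / 2" "(x \<bullet> e / B + 1) / 2 \<le> 1"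
        using B(1) by (auto simp: field_simps abs_le_iff)
      then obtain c where "binary_value c = (x \<bullet> e / B + 1) / 2"
        by (rule binary_value_surj)
      then show ?thesis using B(1) by (intro exI[of _ c]) (simp add: field_simps)
    qed
    then obtain c where c: "\<And>e. e \<in> Basis \<Longrightarrow> B * (2 * binary_value (c e) - 1) = x \<bullet> e"
      by metis
    have "E (\<lambda>(e, k). c e k) = x"
      unfolding E_def by (simp add: c euclidean_representation)
    then show ?thesis by blast
  qed
  show ?thesis
  proof
    show "continuous_on UNIV (\<lambda>b. closest_point \<Omega> (E b))"
      using continuous_on_compose2[OF continuous_on_closest_point[OF assms(2) closed assms(3)] cont] by blast
    show "range (\<lambda>b. closest_point \<Omega> (E b)) = \<Omega>"
    proof
      show "range (\<lambda>b. closest_point \<Omega> (E b)) \<subseteq> \<Omega>"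
        using closest_point_in_set[OF closed assms(3)] by auto
      show "\<Omega> \<subseteq> range (\<lambda>b. closest_point \<Omega> (E b))"
      proof
        fix x assume "x \<in> \<Omega>"
        with surj obtain b where "E b = x" by blast
        then show "x \<in> range (\<lambda>b. closest_point \<Omega> (E b))"
          using closest_point_self[OF \<open>x \<in> \<Omega>\<close>] by (metis rangeI)
      qed
    qed
  qed
qed

section \<open>Probability measures on a compact set\<close>

lemma borel_probsD:
  assumes "\<mu> \<in> borel_probs \<Omega>"
  shows "prob_space \<mu>" "space \<mu> = \<Omega>" "sets \<mu> = sets (restrict_space borel \<Omega>)"
  using assms sets_eq_imp_space_eq[of \<mu> "restrict_space borel \<Omega>"]
  by (auto simp: borel_probs_def space_restrict_space)

lemma borel_probs_measurable:
  assumes "\<mu> \<in> borel_probs \<Omega>" "continuous_on \<Omega> f"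
  shows "f \<in> borel_measurable \<mu>"
  using borel_measurable_continuous_on_restrict[OF assms(2)]
    measurable_cong_sets[OF borel_probsD(3)[OF assms(1)] refl] by blast

lemma borel_probs_integrable:
  fixes f :: "'a::euclidean_space \<Rightarrow> real"
  assumes "\<mu> \<in> borel_probs \<Omega>" "compact \<Omega>" "continuous_on \<Omega> f"
  shows "integrable \<mu> f"
proof -
  interpret prob_space \<mu> using assms(1) by (rule borel_probsD)
  obtain B where "\<And>x. x \<in> \<Omega> \<Longrightarrow> norm (f x) \<le> B"
    using compact_imp_bounded[OF compact_continuous_image[OF assms(3,2)]]
    by (auto simp: bounded_iff)
  then have "AE x in \<mu>. norm (f x) \<le> B"
    using borel_probsD(2)[OF assms(1)] by (intro AE_I2) simp
  then show ?thesis
    using borel_probs_measurable[OF assms(1,3)] by (rule integrable_const_bound)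
qed

section \<open>Lipschitz envelopes of concave functions\<close>

lemma ereal_concave_on_ereal:
  assumes "concave_on K f"
  shows "ereal_concave_on K (\<lambda>x. ereal (f x))"
  using assms unfolding ereal_concave_on_def concave_on_iff by auto

lemma usc_on_ereal:
  fixes f :: "'a::topological_space \<Rightarrow> real"
  assumes f: "continuous_on K f"
  shows "usc_on K (\<lambda>x. ereal (f x))"
  unfolding usc_on_def
proof
  fix a :: ereal
  have "continuous_on K (\<lambda>x. ereal (f x))"
    using f by (intro continuous_intros)
  then have "openin (top_of_set K) (K \<inter> (\<lambda>x. ereal (f x)) -` {..<a})"
    by (rule continuous_openin_preimage_gen) simp
  moreover have "K \<inter> (\<lambda>x. ereal (f x)) -` {..<a} = {x \<in> K. ereal (f x) < a}" by auto
  ultimately show "openin (top_of_set K) {x \<in> K. ereal (f x) < a}" by simp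
qed

lemma usc_on_compact_bounded_above:
  fixes \<psi> :: "'a::topological_space \<Rightarrow> ereal"
  assumes "compact K" "usc_on K \<psi>" "\<And>x. x \<in> K \<Longrightarrow> \<psi> x \<noteq> \<infinity>"
  obtains B :: real where "\<And>x. x \<in> K \<Longrightarrow> \<psi> x \<le> ereal B"
proof -
  let ?U = "\<lambda>n::nat. {x \<in> K. \<psi> x < ereal (real n)}"
  have "\<exists>T. open T \<and> ?U n = K \<inter> T" for n
    using assms(2) by (simp add: usc_on_def openin_open)
  then obtain T where T: "\<And>n. open (T n)" "\<And>n. ?U n = K \<inter> T n" by metis
  have "x \<in> (\<Union>n. T n)" if x: "x \<in> K" for x
  proof -
    obtain n :: nat where "\<psi> x < ereal (real n)"
      using assms(3)[OF x] less_PInf_Ex_of_nat[of "\<psi> x"] by auto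
    then have "x \<in> K \<inter> T n" using T(2)[of n] x by blast
    then show ?thesis by blast
  qed
  then have "K \<subseteq> (\<Union>n. T n)" by blast
  with T(1) obtain J where J: "finite J" "K \<subseteq> (\<Union>n\<in>J. T n)"
    by (rule compactE_image[OF assms(1), of UNIV T])
  show ?thesis
  proof
    fix x assume x: "x \<in> K"
    then obtain n where n: "n \<in> J" "x \<in> T n" using J(2) by blast
    then have "\<psi> x < ereal (real n)" using T(2)[of n] x by blast
    also have "\<dots> \<le> ereal (real (Max J))"
      using n(1) J(1) by simp
    finally show "\<psi> x \<le> ereal (real (Max J))" by simp
  qed
qed

text \<open>The smallest \<open>L\<close>-Lipschitz function above \<open>f\<close> on \<open>D\<close> (sup-convolution with \<open>- L |x|\<close>). It is used
  for \<open>D\<close> nonempty and \<open>f\<close> bounded above on \<open>D\<close>, where the supremum is meaningful.\<close>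
definition envelope :: "'a::euclidean_space set \<Rightarrow> ('a \<Rightarrow> real) \<Rightarrow> real \<Rightarrow> 'a \<Rightarrow> real" where
  "envelope D f L x = (SUP y\<in>D. f y - L * norm (x - y))"

lemma envelope_upper:
  assumes "y \<in> D" "0 \<le> L" "\<And>y. y \<in> D \<Longrightarrow> f y \<le> B"
  shows "f y - L * norm (x - y) \<le> envelope D f L x"
  unfolding envelope_def
proof (rule cSUP_upper[OF assms(1)])
  have "f y - L * norm (x - y) \<le> B" if "y \<in> D" for y
    using assms(3)[OF that] mult_nonneg_nonneg[OF assms(2) norm_ge_zero[of "x - y"]] by linarith
  then show "bdd_above ((\<lambda>y. f y - L * norm (x - y)) ` D)"
    by (rule bdd_aboveI2)
qed

lemma envelope_least:
  assumes "D \<noteq> {}" "\<And>y. y \<in> D \<Longrightarrow> f y - L * norm (x - y) \<le> a"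
  shows "envelope D f L x \<le> a"
  unfolding envelope_def using assms by (rule cSUP_least)

text \<open>The envelope is a partial supremum of the jointly concave function \<open>(x, y) \<mapsto> f y - L |x - y|\<close>.\<close>
lemma convex_on_minus_envelope:
  assumes D: "D \<noteq> {}" and f: "concave_on D f" and L: "0 \<le> L" and B: "\<And>y. y \<in> D \<Longrightarrow> f y \<le> B"
  shows "convex_on UNIV (\<lambda>x. - envelope D f L x)"
proof (rule convex_onI)
  fix t :: real and x y :: 'a
  assume t: "0 < t" "t < 1"
  let ?E = "envelope D f L"
  have "(1 - t) * ?E x + t * ?E y \<le> ?E ((1 - t) *\<^sub>R x + t *\<^sub>R y) + \<epsilon>" if \<epsilon>: "0 < \<epsilon>" for \<epsilon>
  proof -
    have near: "\<exists>y\<in>D. ?E x - \<epsilon> < f y - L * norm (x - y)" for x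
    proof (rule ccontr)
      assume "\<not> ?thesis"
      then have "?E x \<le> ?E x - \<epsilon>" using D by (intro envelope_least) (auto simp: not_less)
      then show False using \<epsilon> by simp
    qed
    obtain u where u: "u \<in> D" "?E x - \<epsilon> < f u - L * norm (x - u)" using near by blast
    obtain v where v: "v \<in> D" "?E y - \<epsilon> < f v - L * norm (y - v)" using near by blast
    let ?z = "(1 - t) *\<^sub>R x + t *\<^sub>R y" and ?m = "(1 - t) *\<^sub>R u + t *\<^sub>R v"
    have conv: "convex D" and conc: "(1 - t) * f u + t * f v \<le> f ?m"
      using f u(1) v(1) t by (auto simp: concave_on_iff)
    then have m: "?m \<in> D" using u(1) v(1) t by (intro convexD) auto
    have "?z - ?m = (1 - t) *\<^sub>R (x - u) + t *\<^sub>R (y - v)" by (simp add: algebra_simps)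
    then have "norm (?z - ?m) \<le> norm ((1 - t) *\<^sub>R (x - u)) + norm (t *\<^sub>R (y - v))"
      by (simp only: norm_triangle_ineq)
    then have "norm (?z - ?m) \<le> (1 - t) * norm (x - u) + t * norm (y - v)"
      using t by simp
    then have "L * norm (?z - ?m) \<le> L * ((1 - t) * norm (x - u) + t * norm (y - v))"
      using L by (rule mult_left_mono)
    moreover have "(1 - t) * (?E x - \<epsilon>) \<le> (1 - t) * (f u - L * norm (x - u))"
      using t u(2) by (intro mult_left_mono) auto
    moreover have "t * (?E y - \<epsilon>) \<le> t * (f v - L * norm (y - v))"
      using t v(2) by (intro mult_left_mono) auto
    moreover have "f ?m - L * norm (?z - ?m) \<le> ?E ?z"
      using envelope_upper[OF m L] B by blast
    ultimately show ?thesis using conc by (simp add: algebra_simps)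
  qed
  then have "(1 - t) * ?E x + t * ?E y \<le> ?E ((1 - t) *\<^sub>R x + t *\<^sub>R y)"
    by (rule field_le_epsilon)
  then show "- ?E ((1 - t) *\<^sub>R x + t *\<^sub>R y) \<le> (1 - t) * - ?E x + t * - ?E y" by simp
qed simp

text \<open>For large \<open>n\<close> the points at distance at least \<open>\<delta>\<close> from \<open>x\<close> are penalised by at least \<open>B - a\<close> and no
  longer matter.\<close>
lemma envelope_eventually_le:
  assumes "D \<noteq> {}" "\<And>y. y \<in> D \<Longrightarrow> f y \<le> B"
    and "0 < \<delta>" "\<And>y. y \<in> D \<Longrightarrow> norm (x - y) < \<delta> \<Longrightarrow> f y \<le> a"
  shows "\<forall>\<^sub>F n in sequentially. envelope D f (real n) x \<le> a"
proof -
  obtain n0 :: nat where n0: "(B - a) / \<delta> \<le> real n0" using real_arch_simple by blast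
  have "envelope D f (real n) x \<le> a" if "n0 \<le> n" for n
  proof (rule envelope_least[OF assms(1)])
    fix y assume y: "y \<in> D"
    show "f y - real n * norm (x - y) \<le> a"
    proof (cases "norm (x - y) < \<delta>")
      case True
      have "0 \<le> real n * norm (x - y)" by simp
      then show ?thesis using assms(4)[OF y True] by linarith
    next
      case False
      have "B - a \<le> real n0 * \<delta>" using n0 assms(3) by (simp add: field_simps)
      also have "\<dots> \<le> real n * norm (x - y)" using False that assms(3) by (intro mult_mono) auto
      finally show ?thesis using assms(2)[OF y] by linarith
    qed
  qed
  then show ?thesis by (auto simp: eventually_sequentially)
qed

text \<open>Approximation from above by functions whose negatives are admissible in the convex order. The envelopes are taken
  over the convex set \<open>D\<close> on which \<open>\<psi>\<close> is finite. At points of \<open>K\<close> outside \<open>D\<close> they still decrease to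
  \<open>-\<infinity>\<close>, by upper semicontinuity.\<close>
lemma usc_concave_approximation:
  fixes \<psi> :: "'a::euclidean_space \<Rightarrow> ereal"
  assumes K: "compact K" and top: "\<And>x. x \<in> K \<Longrightarrow> \<psi> x \<noteq> \<infinity>"
    and conc: "ereal_concave_on K \<psi>" and usc: "usc_on K \<psi>"
    and x0: "x0 \<in> K" "\<psi> x0 \<noteq> -\<infinity>"
  obtains h :: "nat \<Rightarrow> 'a \<Rightarrow> real" and B where "\<And>n. convex_on UNIV (\<lambda>x. - h n x)" "\<And>n x. h n x \<le> B"
    "\<And>n x. x \<in> K \<Longrightarrow> \<psi> x \<le> ereal (h n x)" "\<And>x. x \<in> K \<Longrightarrow> (\<lambda>n. ereal (h n x)) \<longlonglongrightarrow> \<psi> x"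
proof -
  define D where "D = {x \<in> K. \<psi> x \<noteq> -\<infinity>}"
  define f where "f x = real_of_ereal (\<psi> x)" for x
  have D: "D \<noteq> {}" using x0 by (auto simp: D_def)
  have f: "\<psi> x = ereal (f x)" if "x \<in> D" for x
    using that top[of x] by (auto simp: D_def f_def ereal_real)
  obtain B where "\<And>x. x \<in> K \<Longrightarrow> \<psi> x \<le> ereal B"
    using usc_on_compact_bounded_above[OF K usc top] by blast
  then have B: "f x \<le> B" if "x \<in> D" for x
    using f[OF that] that by (force simp: D_def)
  have mid: "u *\<^sub>R x + v *\<^sub>R y \<in> D \<and> u * f x + v * f y \<le> f (u *\<^sub>R x + v *\<^sub>R y)"
    if "x \<in> D" "y \<in> D" "0 \<le> u" "0 \<le> v" "u + v = 1" for x y u v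
  proof -
    let ?z = "u *\<^sub>R x + v *\<^sub>R y"
    have z: "?z \<in> K"
      using conc that by (auto simp: ereal_concave_on_def D_def intro: convexD)
    have "ereal u * \<psi> x + ereal v * \<psi> y \<le> \<psi> ?z"
      using conc that by (simp add: ereal_concave_on_def D_def)
    then have le: "ereal (u * f x + v * f y) \<le> \<psi> ?z"
      using f that by simp
    then have "?z \<in> D" using z by (auto simp: D_def)
    then show ?thesis using le f by simp
  qed
  have concf: "concave_on D f"
    unfolding concave_on_iff convex_def using mid by blast
  define h where "h n = envelope D f (real n)" for n
  have lower: "\<psi> x \<le> ereal (h n x)" if "x \<in> K" for n x
  proof (cases "x \<in> D")
    case True
    have "f x - real n * norm (x - x) \<le> h n x"
      unfolding h_def by (rule envelope_upper[OF True _ B]) auto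
    then show ?thesis using f[OF True] by simp
  next
    case False
    then show ?thesis using that by (simp add: D_def)
  qed
  have lim: "(\<lambda>n. ereal (h n x)) \<longlonglongrightarrow> \<psi> x" if x: "x \<in> K" for x
  proof (rule order_tendstoI)
    fix a assume "a < \<psi> x"
    then show "\<forall>\<^sub>F n in sequentially. a < ereal (h n x)"
      using lower[OF x] by (intro always_eventually) (auto intro: less_le_trans)
  next
    fix a assume "\<psi> x < a"
    then obtain r where r: "\<psi> x < ereal r" "ereal r < a" using ereal_dense2 by blast
    have "openin (top_of_set K) {y \<in> K. \<psi> y < ereal r}" using usc by (simp add: usc_on_def)
    then obtain \<delta> where \<delta>: "0 < \<delta>" "ball x \<delta> \<inter> K \<subseteq> {y \<in> K. \<psi> y < ereal r}"
      using x r(1) unfolding openin_contains_ball by blast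
    have "f y \<le> r" if "y \<in> D" "norm (x - y) < \<delta>" for y
    proof -
      have "y \<in> ball x \<delta> \<inter> K" using that by (simp add: D_def dist_norm)
      then have "\<psi> y < ereal r" using \<delta>(2) by blast
      then show ?thesis using f[OF that(1)] by simp
    qed
    then have "\<forall>\<^sub>F n in sequentially. h n x \<le> r"
      unfolding h_def by (intro envelope_eventually_le[where B = B, OF D _ \<delta>(1)] B)
    then show "\<forall>\<^sub>F n in sequentially. ereal (h n x) < a"
    proof eventually_elim
      case (elim n)
      then have "ereal (h n x) \<le> ereal r" by simp
      then show "ereal (h n x) < a" using r(2) by (rule le_less_trans)
    qed
  qed
  show ?thesis
  proof (rule that[of h B])
    show "convex_on UNIV (\<lambda>x. - h n x)" for n
      unfolding h_def by (rule convex_on_minus_envelope[OF D concf _ B]) auto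
    show "h n x \<le> B" for n x
      unfolding h_def
    proof (rule envelope_least[OF D])
      fix y assume "y \<in> D"
      moreover have "0 \<le> real n * norm (x - y)" by simp
      ultimately show "f y - real n * norm (x - y) \<le> B" using B[of y] by linarith
    qed
  qed (use lower lim in auto)
qed

section \<open>Consequences of the convex order\<close>

lemma cx_le_minus_convex:
  assumes "\<eta> \<le>cx \<mu>" "convex_on UNIV (\<lambda>x. - h x)"
  shows "(\<integral>x. h x \<partial>\<mu>) \<le> (\<integral>x. h x \<partial>\<eta>)"
proof -
  have "(\<integral>x. - h x \<partial>\<eta>) \<le> (\<integral>x. - h x \<partial>\<mu>)"
    using assms(1)[unfolded cx_le_def, rule_format, OF assms(2)] .
  then show ?thesis by simp
qed

lemma convex_on_UNIV_continuous:
  fixes h :: "'a::euclidean_space \<Rightarrow> real"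
  assumes "convex_on UNIV h"
  shows "continuous_on S h"
  using convex_on_continuous[OF open_UNIV assms] by (rule continuous_on_subset) simp

lemma minus_convex_on_UNIV_continuous:
  fixes h :: "'a::euclidean_space \<Rightarrow> real"
  assumes "convex_on UNIV (\<lambda>x. - h x)"
  shows "continuous_on S h"
  using continuous_on_minus[OF convex_on_UNIV_continuous[OF assms]] by simp

text \<open>The convex order tests with finite convex functions on the whole space; a continuous convex function on
  \<open>\<Omega>\<close> need not extend to one (its slope may blow up at the boundary), but it is a bounded limit of such functions.\<close>
lemma cx_le_convex_on:
  fixes \<phi> :: "'a::euclidean_space \<Rightarrow> real"
  assumes \<Omega>: "compact \<Omega>" and \<eta>: "\<eta> \<in> borel_probs \<Omega>" and \<mu>: "\<mu> \<in> borel_probs \<Omega>" and cx: "\<eta> \<le>cx \<mu>"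
    and \<phi>: "convex_on \<Omega> \<phi>" "continuous_on \<Omega> \<phi>"
  shows "(\<integral>x. \<phi> x \<partial>\<eta>) \<le> (\<integral>x. \<phi> x \<partial>\<mu>)"
proof -
  interpret \<eta>: prob_space \<eta> using \<eta> by (rule borel_probsD)
  have "\<Omega> \<noteq> {}" using \<eta>.not_empty borel_probsD(2)[OF \<eta>] by simp
  then obtain x0 where x0: "x0 \<in> \<Omega>" by blast
  let ?\<psi> = "\<lambda>x. ereal (- \<phi> x)"
  have "ereal_concave_on \<Omega> ?\<psi>"
    using \<phi>(1) by (intro ereal_concave_on_ereal) (simp add: concave_on_def)
  moreover have "usc_on \<Omega> ?\<psi>"
    using \<phi>(2) by (intro usc_on_ereal continuous_on_minus)
  ultimately obtain h B where h: "\<And>n. convex_on UNIV (\<lambda>x. - h n x)" "\<And>n x. h n x \<le> B"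
    "\<And>n x. x \<in> \<Omega> \<Longrightarrow> ?\<psi> x \<le> ereal (h n x)" "\<And>x. x \<in> \<Omega> \<Longrightarrow> (\<lambda>n. ereal (h n x)) \<longlonglongrightarrow> ?\<psi> x"
    using usc_concave_approximation[OF \<Omega> _ _ _ x0, of ?\<psi>] by auto
  obtain C where C: "\<And>x. x \<in> \<Omega> \<Longrightarrow> \<bar>\<phi> x\<bar> \<le> C"
    using compact_imp_bounded[OF compact_continuous_image[OF \<phi>(2) \<Omega>]]
    by (auto simp: bounded_iff)
  have lim: "(\<lambda>n. \<integral>x. h n x \<partial>\<nu>) \<longlonglongrightarrow> (\<integral>x. - \<phi> x \<partial>\<nu>)" if \<nu>: "\<nu> \<in> borel_probs \<Omega>" for \<nu>
  proof (rule integral_dominated_convergence)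
    interpret \<nu>: prob_space \<nu> using \<nu> by (rule borel_probsD)
    show "integrable \<nu> (\<lambda>_. \<bar>B\<bar> + C)" by simp
    show "AE x in \<nu>. (\<lambda>n. h n x) \<longlonglongrightarrow> - \<phi> x"
      using h(4) borel_probsD(2)[OF \<nu>] by (intro AE_I2) simp
    show "AE x in \<nu>. norm (h n x) \<le> \<bar>B\<bar> + C" for n
    proof (rule AE_I2)
      fix x assume "x \<in> space \<nu>"
      then have x: "x \<in> \<Omega>" using borel_probsD(2)[OF \<nu>] by simp
      show "norm (h n x) \<le> \<bar>B\<bar> + C"
        using h(2)[of n x] h(3)[OF x, of n] C[OF x] by (simp add: abs_le_iff) linarith
    qed
  qed (use \<nu> \<phi> h in \<open>auto intro!: borel_probs_measurable[OF \<nu>] continuous_on_minus minus_convex_on_UNIV_continuous\<close>)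
  have "(\<integral>x. - \<phi> x \<partial>\<mu>) \<le> (\<integral>x. - \<phi> x \<partial>\<eta>)"
    using cx_le_minus_convex[OF cx h(1)] by (intro LIMSEQ_le[OF lim[OF \<mu>] lim[OF \<eta>]]) auto
  then show ?thesis by simp
qed

text \<open>Minus the distance to \<open>K\<close>, here the envelope of the zero function, is concave and has integral 0 under
  \<open>\<mu>\<close>. Hence it has nonnegative integral under \<open>\<eta>\<close>, and being nonpositive it vanishes almost everywhere.\<close>
lemma cx_le_concentrated:
  fixes K :: "'a::euclidean_space set"
  assumes \<Omega>: "compact \<Omega>" and \<eta>: "\<eta> \<in> borel_probs \<Omega>" and \<mu>: "\<mu> \<in> borel_probs \<Omega>" and cx: "\<eta> \<le>cx \<mu>"
    and K: "closed K" "convex K" "AE x in \<mu>. x \<in> K"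
  shows "AE x in \<eta>. x \<in> K"
proof -
  interpret \<mu>: prob_space \<mu> using \<mu> by (rule borel_probsD)
  have ne: "K \<noteq> {}"
    using K(3) \<mu>.AE_False by auto
  let ?E = "envelope K (\<lambda>_. 0) 1"
  have nonpos: "?E x \<le> 0" for x by (rule envelope_least[OF ne]) simp
  have zero: "?E x = 0" if "x \<in> K" for x
    using envelope_upper[of x K 1 "\<lambda>_. 0" 0 x] that nonpos[of x] by simp
  have conv: "convex_on UNIV (\<lambda>x. - ?E x)"
    using K(2) by (intro convex_on_minus_envelope[OF ne, of _ _ 0]) (auto simp: concave_on_iff)
  have "(\<integral>x. ?E x \<partial>\<mu>) = 0"
    using K(3) zero by (intro integral_eq_zero_AE) auto
  then have "0 \<le> (\<integral>x. ?E x \<partial>\<eta>)"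
    using cx_le_minus_convex[OF cx conv] by simp
  moreover have "0 \<le> (\<integral>x. - ?E x \<partial>\<eta>)"
    using nonpos by (intro Bochner_Integration.integral_nonneg) simp
  ultimately have "(\<integral>x. - ?E x \<partial>\<eta>) = 0" by simp
  moreover have "integrable \<eta> (\<lambda>x. - ?E x)"
    using conv by (intro borel_probs_integrable[OF \<eta> \<Omega>] convex_on_UNIV_continuous)
  ultimately have "AE x in \<eta>. - ?E x = 0"
    using nonpos by (subst (asm) integral_nonneg_eq_0_iff_AE) auto
  then show ?thesis
  proof (rule AE_mp, intro AE_I2 impI)
    fix x assume x: "- ?E x = 0"
    show "x \<in> K"
    proof (rule ccontr)
      assume "x \<notin> K"
      then obtain \<delta> where \<delta>: "0 < \<delta>" "ball x \<delta> \<subseteq> - K"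
        using K(1) by (metis ComplI open_Compl openE)
      have "?E x \<le> - \<delta>"
      proof (rule envelope_least[OF ne])
        fix y assume "y \<in> K"
        then have "\<not> dist x y < \<delta>" using \<delta>(2) by auto
        then show "0 - 1 * norm (x - y) \<le> - \<delta>" by (simp add: dist_norm)
      qed
      then show False using x \<delta>(1) by simp
    qed
  qed
qed

section \<open>Support of a measure and its convex hull\<close>

text \<open>The complement of the support is the union of all open null sets, and by the Lindelof property countably
  many of them suffice.\<close>
lemma msupp_props:
  fixes \<Omega> :: "'a::euclidean_space set"
  assumes \<mu>: "\<mu> \<in> borel_probs \<Omega>" and \<Omega>: "compact \<Omega>"
  shows "compact (msupp \<mu>)" and "AE x in \<mu>. x \<in> msupp \<mu>" and "msupp \<mu> \<subseteq> \<Omega>"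
proof -
  note sp = borel_probsD[OF \<mu>]
  let ?F = "{U. open U \<and> emeasure \<mu> (U \<inter> \<Omega>) = 0}"
  have eq: "msupp \<mu> = \<Omega> - \<Union>?F"
    by (auto simp: msupp_def sp(2) zero_less_iff_neq_zero)
  show "msupp \<mu> \<subseteq> \<Omega>" by (simp add: eq)
  show "compact (msupp \<mu>)"
    unfolding eq using \<Omega> by (intro compact_diff open_Union) auto
  obtain F' where F': "F' \<subseteq> ?F" "countable F'" "\<Union>F' = \<Union>?F"
    using Lindelof[of ?F] by auto
  have "(\<Union>U\<in>F'. U \<inter> \<Omega>) \<in> null_sets \<mu>"
  proof (rule null_sets_UN'[OF F'(2)])
    fix U assume "U \<in> F'"
    then have "open U" "emeasure \<mu> (U \<inter> \<Omega>) = 0" using F'(1) by auto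
    then show "U \<inter> \<Omega> \<in> null_sets \<mu>"
      using \<Omega> by (auto simp: null_sets_def sp(3) sets_restrict_space)
  qed
  moreover have "{x \<in> space \<mu>. x \<notin> msupp \<mu>} = (\<Union>U\<in>F'. U \<inter> \<Omega>)"
    unfolding eq F'(3)[symmetric] sp(2) by auto
  ultimately show "AE x in \<mu>. x \<in> msupp \<mu>"
    by (auto intro: AE_I')
qed

lemma supp_hull_props:
  fixes \<Omega> :: "'a::euclidean_space set"
  assumes \<mu>: "\<mu> \<in> borel_probs \<Omega>" and \<Omega>: "compact \<Omega>" "convex \<Omega>"
  shows "compact (supp_hull \<mu>)" "convex (supp_hull \<mu>)" "AE x in \<mu>. x \<in> supp_hull \<mu>"
    "supp_hull \<mu> \<subseteq> \<Omega>" "supp_hull \<mu> \<in> sets \<mu>"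
proof -
  note s = msupp_props[OF \<mu> \<Omega>(1)]
  show c: "compact (supp_hull \<mu>)"
    unfolding supp_hull_def using s(1) by (rule compact_convex_hull)
  show "convex (supp_hull \<mu>)"
    unfolding supp_hull_def by (rule convex_convex_hull)
  show "AE x in \<mu>. x \<in> supp_hull \<mu>"
    using s(2) hull_subset[of "msupp \<mu>" convex] unfolding supp_hull_def by (auto elim: eventually_mono)
  show sub: "supp_hull \<mu> \<subseteq> \<Omega>"
    unfolding supp_hull_def using s(3) \<Omega>(2) by (rule hull_minimal)
  show "supp_hull \<mu> \<in> sets \<mu>"
    unfolding borel_probsD(3)[OF \<mu>] sets_restrict_space
    using sub c by (intro image_eqI[of _ _ "supp_hull \<mu>"]) (auto intro: borel_compact)
qed

section \<open>The infimal convolution cost\<close>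

definition transport_cost :: "nat \<Rightarrow> real \<Rightarrow> (nat \<Rightarrow> real) \<Rightarrow> (nat \<Rightarrow> 'a::euclidean_space) \<Rightarrow> 'a \<Rightarrow> real" where
  "transport_cost N p w x z = (\<Sum>i=1..N. w i * norm (x i - z) powr p)"

lemma cbar_eq: "cbar \<Omega> N p w x = (INF z\<in>\<Omega>. transport_cost N p w x z)"
  by (simp add: cbar_def transport_cost_def)

lemma norm_powr_uniformly_continuous:
  fixes R \<epsilon> p :: real
  assumes "0 < p" "0 < \<epsilon>"
  obtains \<delta> where "0 < \<delta>"
    "\<And>u v :: 'a::euclidean_space. norm u \<le> R \<Longrightarrow> norm v \<le> R \<Longrightarrow> norm (u - v) < \<delta> \<Longrightarrow>
       \<bar>norm u powr p - norm v powr p\<bar> \<le> \<epsilon>"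
proof -
  have "continuous_on (cball 0 R) (\<lambda>u :: 'a. norm u powr p)"
    using assms(1) by (intro continuous_on_powr' continuous_intros) auto
  then have "uniformly_continuous_on (cball 0 R) (\<lambda>u :: 'a. norm u powr p)"
    by (rule compact_uniformly_continuous) simp
  then obtain \<delta> where \<delta>: "0 < \<delta>" "\<And>u v :: 'a. u \<in> cball 0 R \<Longrightarrow> v \<in> cball 0 R \<Longrightarrow>
      dist v u < \<delta> \<Longrightarrow> dist (norm v powr p) (norm u powr p) < \<epsilon>"
    using assms(2) unfolding uniformly_continuous_on_def by metis
  show ?thesis
  proof (rule that[OF \<delta>(1)])
    fix u v :: 'a assume "norm u \<le> R" "norm v \<le> R" "norm (u - v) < \<delta>"
    then show "\<bar>norm u powr p - norm v powr p\<bar> \<le> \<epsilon>"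
      using \<delta>(2)[of v u] by (simp add: dist_norm)
  qed
qed

text \<open>The part of the hypotheses that concerns the cost. The weights enter through their signs and their sum,
  so that a uniform error in each distance becomes the same error in the cost.\<close>
locale barycenter_cost =
  fixes \<Omega> :: "'a::euclidean_space set" and N :: nat and p :: real and w :: "nat \<Rightarrow> real"
  assumes compact: "compact \<Omega>" and nonempty: "\<Omega> \<noteq> {}" and p: "0 < p"
    and w_nonneg: "\<And>i. i \<in> {1..N} \<Longrightarrow> 0 \<le> w i" and w_sum: "(\<Sum>i=1..N. w i) = 1"
begin

abbreviation "cost \<equiv> transport_cost N p w"

lemma radius: obtains R where "0 < R" "\<And>x z. x \<in> \<Omega> \<Longrightarrow> z \<in> \<Omega> \<Longrightarrow> norm (x - z) \<le> R"
proof -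
  obtain B where B: "0 < B" "\<And>x. x \<in> \<Omega> \<Longrightarrow> norm x \<le> B"
    using compact_imp_bounded[OF compact] bounded_pos by blast
  show ?thesis
  proof (rule that[of "2 * B"])
    fix x z assume "x \<in> \<Omega>" "z \<in> \<Omega>"
    then show "norm (x - z) \<le> 2 * B"
      using norm_triangle_ineq4[of x z] B(2)[of x] B(2)[of z] by linarith
  qed (use B in simp)
qed

lemma cost_nonneg: "0 \<le> cost x z"
  unfolding transport_cost_def using w_nonneg by (intro sum_nonneg mult_nonneg_nonneg) auto

lemma cost_bdd_below: "bdd_below (cost x ` S)"
  by (rule bdd_belowI2[of _ 0]) (rule cost_nonneg)

lemma cbar_nonneg: "0 \<le> cbar \<Omega> N p w x"
  unfolding cbar_eq using nonempty cost_nonneg by (intro cINF_greatest) auto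

lemma cbar_le_cost: "z \<in> \<Omega> \<Longrightarrow> cbar \<Omega> N p w x \<le> cost x z"
  unfolding cbar_eq by (rule cINF_lower[OF cost_bdd_below])

text \<open>A one-sided bound, uniform in all variables. It gives the continuity of the cost after taking infima, and
  it allows \<open>z\<close> to be restricted to a countable dense set.\<close>
lemma cost_uniformly_continuous:
  assumes "0 < \<epsilon>"
  obtains \<delta> where "0 < \<delta>" "\<And>x y z z'. (\<And>i. i \<in> {1..N} \<Longrightarrow> x i \<in> \<Omega> \<and> y i \<in> \<Omega> \<and> dist (x i) (y i) < \<delta>) \<Longrightarrow>
    z \<in> \<Omega> \<Longrightarrow> z' \<in> \<Omega> \<Longrightarrow> dist z z' < \<delta> \<Longrightarrow> cost x z \<le> cost y z' + \<epsilon>"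
proof -
  obtain R where R: "\<And>x z. x \<in> \<Omega> \<Longrightarrow> z \<in> \<Omega> \<Longrightarrow> norm (x - z) \<le> R" using radius by blast
  obtain \<delta> where \<delta>: "0 < \<delta>" "\<And>u v :: 'a. norm u \<le> R \<Longrightarrow> norm v \<le> R \<Longrightarrow> norm (u - v) < \<delta> \<Longrightarrow>
       \<bar>norm u powr p - norm v powr p\<bar> \<le> \<epsilon>"
    using norm_powr_uniformly_continuous[OF p assms] by blast
  show ?thesis
  proof (rule that[of "\<delta>/2"])
    show "0 < \<delta>/2" using \<delta>(1) by simp
    fix x y z z'
    assume xy: "\<And>i. i \<in> {1..N} \<Longrightarrow> x i \<in> \<Omega> \<and> y i \<in> \<Omega> \<and> dist (x i) (y i) < \<delta>/2"
      and z: "z \<in> \<Omega>" "z' \<in> \<Omega>" "dist z z' < \<delta>/2"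
    have "w i * norm (x i - z) powr p \<le> w i * norm (y i - z') powr p + w i * \<epsilon>"
      if i: "i \<in> {1..N}" for i
    proof -
      have "(x i - z) - (y i - z') = (x i - y i) - (z - z')" by simp
      then have "norm ((x i - z) - (y i - z')) \<le> norm (x i - y i) + norm (z - z')"
        by (simp only: norm_triangle_ineq4)
      then have "norm ((x i - z) - (y i - z')) < \<delta>"
        using xy[OF i] z(3) by (simp add: dist_norm)
      then have "\<bar>norm (x i - z) powr p - norm (y i - z') powr p\<bar> \<le> \<epsilon>"
        using xy[OF i] z R by (intro \<delta>(2)) auto
      then have "norm (x i - z) powr p \<le> norm (y i - z') powr p + \<epsilon>" by linarith
      from mult_left_mono[OF this w_nonneg[OF i]] show ?thesis by (simp add: algebra_simps)
    qed
    then have "cost x z \<le> (\<Sum>i=1..N. w i * norm (y i - z') powr p + w i * \<epsilon>)"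
      unfolding transport_cost_def by (rule sum_mono)
    also have "\<dots> = cost y z' + (\<Sum>i=1..N. w i) * \<epsilon>"
      by (simp add: transport_cost_def sum.distrib sum_distrib_right)
    finally show "cost x z \<le> cost y z' + \<epsilon>" using w_sum by simp
  qed
qed

lemma cbar_uniformly_continuous:
  assumes "0 < \<epsilon>"
  obtains \<delta> where "0 < \<delta>" "\<And>x y. (\<And>i. i \<in> {1..N} \<Longrightarrow> x i \<in> \<Omega> \<and> y i \<in> \<Omega> \<and> dist (x i) (y i) < \<delta>) \<Longrightarrow>
    \<bar>cbar \<Omega> N p w x - cbar \<Omega> N p w y\<bar> \<le> \<epsilon>"
proof -
  obtain \<delta> where \<delta>: "0 < \<delta>" "\<And>x y z z'. (\<And>i. i \<in> {1..N} \<Longrightarrow> x i \<in> \<Omega> \<and> y i \<in> \<Omega> \<and> dist (x i) (y i) < \<delta>) \<Longrightarrow>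
    z \<in> \<Omega> \<Longrightarrow> z' \<in> \<Omega> \<Longrightarrow> dist z z' < \<delta> \<Longrightarrow> cost x z \<le> cost y z' + \<epsilon>"
    using cost_uniformly_continuous[OF assms] by blast
  have le: "cbar \<Omega> N p w x \<le> cbar \<Omega> N p w y + \<epsilon>"
    if xy: "\<And>i. i \<in> {1..N} \<Longrightarrow> x i \<in> \<Omega> \<and> y i \<in> \<Omega> \<and> dist (x i) (y i) < \<delta>" for x y
  proof -
    have "cbar \<Omega> N p w x - \<epsilon> \<le> cost y z" if z: "z \<in> \<Omega>" for z
    proof -
      have "cost x z \<le> cost y z + \<epsilon>"
        using \<delta>(1) z by (intro \<delta>(2) xy) auto
      then show ?thesis using cbar_le_cost[OF z, of x] by linarith
    qed
    then have "cbar \<Omega> N p w x - \<epsilon> \<le> cbar \<Omega> N p w y"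
      unfolding cbar_eq[of _ _ _ _ y] using nonempty by (intro cINF_greatest) auto
    then show ?thesis by simp
  qed
  show ?thesis
  proof (rule that[OF \<delta>(1)])
    fix x y assume xy: "\<And>i. i \<in> {1..N} \<Longrightarrow> x i \<in> \<Omega> \<and> y i \<in> \<Omega> \<and> dist (x i) (y i) < \<delta>"
    have "cbar \<Omega> N p w x \<le> cbar \<Omega> N p w y + \<epsilon>" using xy by (rule le)
    moreover have "cbar \<Omega> N p w y \<le> cbar \<Omega> N p w x + \<epsilon>"
      using xy by (intro le) (auto simp: dist_commute)
    ultimately show "\<bar>cbar \<Omega> N p w x - cbar \<Omega> N p w y\<bar> \<le> \<epsilon>" by linarith
  qed
qed

lemma cbar_bounded:
  obtains C where "0 \<le> C" "\<And>x. (\<And>i. i \<in> {1..N} \<Longrightarrow> x i \<in> \<Omega>) \<Longrightarrow> cbar \<Omega> N p w x \<le> C"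
proof -
  obtain z where z: "z \<in> \<Omega>" using nonempty by blast
  obtain R where R: "0 < R" "\<And>x z. x \<in> \<Omega> \<Longrightarrow> z \<in> \<Omega> \<Longrightarrow> norm (x - z) \<le> R" using radius by blast
  show ?thesis
  proof (rule that[of "R powr p"])
    fix x assume x: "\<And>i. i \<in> {1..N} \<Longrightarrow> x i \<in> \<Omega>"
    have "cost x z \<le> (\<Sum>i=1..N. w i * R powr p)"
      unfolding transport_cost_def
      using x z R p w_nonneg by (intro sum_mono mult_left_mono powr_mono2) auto
    also have "\<dots> = R powr p" using w_sum by (simp add: sum_distrib_right[symmetric])
    finally show "cbar \<Omega> N p w x \<le> R powr p" using cbar_le_cost[OF z, of x] by simp
  qed simp
qed

text \<open>The infimum of a possibly uncountable family of measurable functions; by uniform continuity in \<open>z\<close> a countable dense subset of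
  \<open>\<Omega>\<close> gives the same infimum.\<close>
lemma cbar_measurable:
  "cbar \<Omega> N p w \<in> borel_measurable (PiM {1..N} (\<lambda>_. restrict_space borel \<Omega>))"
proof -
  let ?P = "PiM {1..N} (\<lambda>_. restrict_space borel \<Omega>)"
  obtain Z where Z: "countable Z" "Z \<subseteq> \<Omega>" "\<Omega> \<subseteq> closure Z"
    using separable[of \<Omega>] by blast
  have Zne: "Z \<noteq> {}" using Z(3) nonempty by auto
  have eq: "cbar \<Omega> N p w x = (INF z\<in>Z. cost x z)" if x: "x \<in> space ?P" for x
  proof (rule antisym)
    have x: "x i \<in> \<Omega>" if "i \<in> {1..N}" for i
      using x that by (auto simp: space_PiM space_restrict_space)
    show "cbar \<Omega> N p w x \<le> (INF z\<in>Z. cost x z)"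
      using Zne Z(2) cbar_le_cost by (intro cINF_greatest) auto
    have "(INF z\<in>Z. cost x z) \<le> cost x z" if z: "z \<in> \<Omega>" for z
    proof (rule field_le_epsilon)
      fix \<epsilon> :: real assume "0 < \<epsilon>"
      then obtain \<delta> where \<delta>: "0 < \<delta>" "\<And>x y z z'. (\<And>i. i \<in> {1..N} \<Longrightarrow> x i \<in> \<Omega> \<and> y i \<in> \<Omega> \<and> dist (x i) (y i) < \<delta>) \<Longrightarrow>
          z \<in> \<Omega> \<Longrightarrow> z' \<in> \<Omega> \<Longrightarrow> dist z z' < \<delta> \<Longrightarrow> cost x z \<le> cost y z' + \<epsilon>"
        using cost_uniformly_continuous by blast
      obtain z' where z': "z' \<in> Z" "dist z' z < \<delta>"
        using z Z(3) \<delta>(1) by (meson closure_approachable subsetD)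
      have "(INF z\<in>Z. cost x z) \<le> cost x z'" using z'(1) by (rule cINF_lower[OF cost_bdd_below])
      also have "\<dots> \<le> cost x z + \<epsilon>"
        using \<delta>(1) x z z' Z(2) by (intro \<delta>(2)) auto
      finally show "(INF z\<in>Z. cost x z) \<le> cost x z + \<epsilon>" .
    qed
    then show "(INF z\<in>Z. cost x z) \<le> cbar \<Omega> N p w x"
      unfolding cbar_eq using nonempty by (intro cINF_greatest) auto
  qed
  have "(\<lambda>x. cost x z) \<in> borel_measurable ?P" for z
    unfolding transport_cost_def
  proof (rule borel_measurable_sum)
    fix i assume "i \<in> {1..N}"
    then have "(\<lambda>x. x i) \<in> measurable ?P (restrict_space borel \<Omega>)"
      by (rule measurable_component_singleton)
    from measurable_compose[OF this measurable_restrict_space1[OF measurable_ident_sets[OF refl]]]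
    have [measurable]: "(\<lambda>x. x i) \<in> borel_measurable ?P" .
    show "(\<lambda>x. w i * norm (x i - z) powr p) \<in> borel_measurable ?P"
      by measurable
  qed
  then have "(\<lambda>x. INF z\<in>Z. cost x z) \<in> borel_measurable ?P"
    using Z(1) cost_bdd_below by (intro borel_measurable_cINF) auto
  then show ?thesis
    using eq by (subst measurable_cong) auto
qed

end

section \<open>Weak duality for the relaxed dual\<close>

lemma borel_probs_prodD:
  assumes "\<gamma> \<in> borel_probs_prod \<Omega> N"
  shows "prob_space \<gamma>" "sets \<gamma> = sets (PiM {1..N} (\<lambda>_. restrict_space borel \<Omega>))"
    "space \<gamma> = PiE {1..N} (\<lambda>_. \<Omega>)"
    "i \<in> {1..N} \<Longrightarrow> (\<lambda>x. x i) \<in> measurable \<gamma> (restrict_space borel \<Omega>)"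
proof -
  show "prob_space \<gamma>" and sets: "sets \<gamma> = sets (PiM {1..N} (\<lambda>_. restrict_space borel \<Omega>))"
    using assms by (auto simp: borel_probs_prod_def)
  show "space \<gamma> = PiE {1..N} (\<lambda>_. \<Omega>)"
    using sets_eq_imp_space_eq[OF sets] by (simp add: space_PiM space_restrict_space)
  show "(\<lambda>x. x i) \<in> measurable \<gamma> (restrict_space borel \<Omega>)" if "i \<in> {1..N}"
    using measurable_component_singleton[OF that, of "\<lambda>_. restrict_space borel \<Omega>"]
      measurable_cong_sets[OF sets refl] by blast
qed

lemma marginal_borel_probs:
  assumes "\<gamma> \<in> borel_probs_prod \<Omega> N" "i \<in> {1..N}"
  shows "marginal \<Omega> i \<gamma> \<in> borel_probs \<Omega>"
  using prob_space.prob_space_distr[OF borel_probs_prodD(1,4)[OF assms(1)]] assms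
  by (auto simp: borel_probs_def marginal_def)

lemma integral_marginal:
  fixes f :: "'a::euclidean_space \<Rightarrow> real"
  assumes "\<gamma> \<in> borel_probs_prod \<Omega> N" "i \<in> {1..N}" "continuous_on \<Omega> f"
  shows "(\<integral>x. f x \<partial>marginal \<Omega> i \<gamma>) = (\<integral>x. f (x i) \<partial>\<gamma>)"
  unfolding marginal_def
  by (rule integral_distr[OF borel_probs_prodD(4)[OF assms(1,2)] borel_measurable_continuous_on_restrict[OF assms(3)]])

lemma integrable_marginal:
  fixes f :: "'a::euclidean_space \<Rightarrow> real"
  assumes "compact \<Omega>" "\<gamma> \<in> borel_probs_prod \<Omega> N" "i \<in> {1..N}" "continuous_on \<Omega> f"
  shows "integrable \<gamma> (\<lambda>x. f (x i))"
  using borel_probs_integrable[OF marginal_borel_probs[OF assms(2,3)] assms(1,4)]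
    integrable_distr_eq[OF borel_probs_prodD(4)[OF assms(2,3)] borel_measurable_continuous_on_restrict[OF assms(4)]]
  unfolding marginal_def by simp

lemma tendsto_sum_ereal_not_PInfty:
  fixes f :: "'i \<Rightarrow> 'b \<Rightarrow> ereal"
  assumes "finite A" "\<And>i. i \<in> A \<Longrightarrow> (f i \<longlongrightarrow> l i) F" "\<And>i. i \<in> A \<Longrightarrow> l i \<noteq> \<infinity>"
  shows "((\<lambda>x. \<Sum>i\<in>A. f i x) \<longlongrightarrow> (\<Sum>i\<in>A. l i)) F \<and> (\<Sum>i\<in>A. l i) \<noteq> \<infinity>"
  using assms
proof (induction A)
  case (insert a A)
  then have IH: "((\<lambda>x. \<Sum>i\<in>A. f i x) \<longlongrightarrow> (\<Sum>i\<in>A. l i)) F" "(\<Sum>i\<in>A. l i) \<noteq> \<infinity>" by auto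
  have "((\<lambda>x. f a x + (\<Sum>i\<in>A. f i x)) \<longlongrightarrow> l a + (\<Sum>i\<in>A. l i)) F"
    using insert.prems IH by (intro tendsto_add_ereal_general) auto
  then show ?case using insert IH by simp
qed simp

text \<open>Let \<open>F n\<close> be the sum of the potentials with the concave ones replaced by their envelopes. The convex order
  and \<open>\<psi> i \<le> h i n\<close> give \<open>V \<le> \<integral>F n d\<gamma> \<le> \<integral>max (F n) c d\<gamma>\<close>. Almost everywhere \<open>F n\<close> converges to
  a limit that is at most \<open>c\<close>, possibly \<open>-\<infinity>\<close>, so that \<open>max (F n) c\<close> tends to \<open>c\<close> and stays bounded.\<close>
lemma relaxed_dual_le_plan:
  fixes \<Omega> :: "'a::euclidean_space set"
  assumes bc: "barycenter_cost \<Omega> N p w" and \<Omega>: "convex \<Omega>" and MN: "M \<le> N"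
    and \<mu>: "\<And>i. i \<in> {1..N} \<Longrightarrow> \<mu> i \<in> borel_probs \<Omega>"
    and adm: "(\<phi>, \<psi>) \<in> relaxed_admissible \<Omega> M N p w \<mu>"
    and \<gamma>: "\<gamma> \<in> cx_plans \<Omega> M N \<mu>"
  shows "(\<Sum>i=1..M. \<integral>x. \<phi> i x \<partial>\<mu> i) + (\<Sum>i=M+1..N. LINT x:supp_hull (\<mu> i)|\<mu> i. real_of_ereal (\<psi> i x))
    \<le> (\<integral>x. cbar \<Omega> N p w x \<partial>\<gamma>)"
proof -
  interpret barycenter_cost \<Omega> N p w by fact
  let ?c = "cbar \<Omega> N p w" and ?K = "\<lambda>i. supp_hull (\<mu> i)"
  have \<gamma>P: "\<gamma> \<in> borel_probs_prod \<Omega> N" using \<gamma> by (simp add: cx_plans_def)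
  note \<gamma>D = borel_probs_prodD[OF \<gamma>P]
  interpret \<gamma>: prob_space \<gamma> by (rule \<gamma>D(1))
  have I1: "i \<in> {1..N}" if "i \<in> {1..M}" for i using that MN by auto
  have I2: "i \<in> {1..N}" if "i \<in> {M+1..N}" for i using that by auto
  have \<phi>: "convex_on \<Omega> (\<phi> i)" "continuous_on \<Omega> (\<phi> i)" if "i \<in> {1..M}" for i
    using adm that by (auto simp: relaxed_admissible_def)
  have \<psi>: "\<And>x. x \<in> ?K i \<Longrightarrow> \<psi> i x \<noteq> \<infinity>" "ereal_concave_on (?K i) (\<psi> i)" "usc_on (?K i) (\<psi> i)"
    "AE x in \<mu> i. x \<in> ?K i \<longrightarrow> \<bar>\<psi> i x\<bar> \<noteq> \<infinity>" "set_integrable (\<mu> i) (?K i) (\<lambda>x. real_of_ereal (\<psi> i x))"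
    if "i \<in> {M+1..N}" for i
    using adm that by (auto simp: relaxed_admissible_def ereal_L1_on_def)
  have K: "compact (?K i)" "convex (?K i)" "AE x in \<mu> i. x \<in> ?K i" "?K i \<subseteq> \<Omega>" "?K i \<in> sets (\<mu> i)"
    if "i \<in> {M+1..N}" for i
    using supp_hull_props[OF \<mu>[OF I2[OF that]] compact \<Omega>] by auto
  have cx1: "\<mu> i \<le>cx marginal \<Omega> i \<gamma>" if "i \<in> {1..M}" for i
    using \<gamma> that by (simp add: cx_plans_def)
  have cx2: "marginal \<Omega> i \<gamma> \<le>cx \<mu> i" if "i \<in> {M+1..N}" for i
    using \<gamma> that by (simp add: cx_plans_def)
  have "\<exists>h. (\<exists>B. \<forall>n x. h n x \<le> B) \<and> (\<forall>n. convex_on UNIV (\<lambda>x. - h n x)) \<and>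
      (\<forall>n. \<forall>x\<in>?K i. \<psi> i x \<le> ereal (h n x)) \<and> (\<forall>x\<in>?K i. (\<lambda>n. ereal (h n x)) \<longlonglongrightarrow> \<psi> i x)"
    if i: "i \<in> {M+1..N}" for i
  proof -
    interpret \<mu>i: prob_space "\<mu> i" using \<mu>[OF I2[OF i]] by (rule borel_probsD)
    have "\<exists>x0. x0 \<in> ?K i \<and> \<psi> i x0 \<noteq> -\<infinity>"
    proof (rule ccontr)
      assume none: "\<not> ?thesis"
      have "AE x in \<mu> i. False"
        using K(3)[OF i] \<psi>(4)[OF i] by eventually_elim (use none in auto)
      then show False using \<mu>i.AE_False by simp
    qed
    then obtain x0 where x0: "x0 \<in> ?K i" "\<psi> i x0 \<noteq> -\<infinity>" by blast
    show ?thesis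
      by (rule usc_concave_approximation[OF K(1)[OF i] \<psi>(1)[OF i] \<psi>(2)[OF i] \<psi>(3)[OF i] x0]) blast+
  qed
  then obtain h where h: "\<And>i. i \<in> {M+1..N} \<Longrightarrow> \<exists>B. \<forall>n x. h i n x \<le> B"
    "\<And>i n. i \<in> {M+1..N} \<Longrightarrow> convex_on UNIV (\<lambda>x. - h i n x)"
    "\<And>i n x. i \<in> {M+1..N} \<Longrightarrow> x \<in> ?K i \<Longrightarrow> \<psi> i x \<le> ereal (h i n x)"
    "\<And>i x. i \<in> {M+1..N} \<Longrightarrow> x \<in> ?K i \<Longrightarrow> (\<lambda>n. ereal (h i n x)) \<longlonglongrightarrow> \<psi> i x"
    by metis
  \<comment> \<open>Only upper bounds are needed: the maximum with the cost is nonnegative.\<close>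
  obtain B where B: "\<And>i n x. i \<in> {M+1..N} \<Longrightarrow> h i n x \<le> B i" using h(1) by metis
  have hcont: "continuous_on \<Omega> (h i n)" if "i \<in> {M+1..N}" for i n
    using h(2)[OF that] by (rule minus_convex_on_UNIV_continuous)
  have "\<exists>C. \<forall>x\<in>\<Omega>. \<phi> i x \<le> C" if i: "i \<in> {1..M}" for i
    using bounded_imp_bdd_above[OF compact_imp_bounded[OF compact_continuous_image[OF \<phi>(2)[OF i] compact]]]
    unfolding bdd_above_def by auto
  then obtain A where A: "\<And>i x. i \<in> {1..M} \<Longrightarrow> x \<in> \<Omega> \<Longrightarrow> \<phi> i x \<le> A i" by metis
  obtain C where C: "0 \<le> C" "\<And>x. (\<And>i. i \<in> {1..N} \<Longrightarrow> x i \<in> \<Omega>) \<Longrightarrow> ?c x \<le> C"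
    using cbar_bounded by blast
  define F where "F n x = (\<Sum>i=1..M. \<phi> i (x i)) + (\<Sum>i=M+1..N. h i n (x i))" for n x
  have F_int: "integrable \<gamma> (F n)" for n
    unfolding F_def using \<phi>(2) hcont I1 I2
    by (intro Bochner_Integration.integrable_add Bochner_Integration.integrable_sum integrable_marginal[OF compact \<gamma>P]) auto
  let ?V = "(\<Sum>i=1..M. \<integral>x. \<phi> i x \<partial>\<mu> i) + (\<Sum>i=M+1..N. LINT x:?K i|\<mu> i. real_of_ereal (\<psi> i x))"
  have V_le: "?V \<le> (\<integral>x. F n x \<partial>\<gamma>)" for n
  proof -
    have 1: "(\<integral>x. \<phi> i x \<partial>\<mu> i) \<le> (\<integral>x. \<phi> i (x i) \<partial>\<gamma>)" if i: "i \<in> {1..M}" for i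
      using cx_le_convex_on[OF compact \<mu>[OF I1[OF i]] marginal_borel_probs[OF \<gamma>P I1[OF i]] cx1[OF i] \<phi>[OF i]]
        integral_marginal[OF \<gamma>P I1[OF i] \<phi>(2)[OF i]] by simp
    have 2: "(LINT x:?K i|\<mu> i. real_of_ereal (\<psi> i x)) \<le> (\<integral>x. h i n (x i) \<partial>\<gamma>)"
      if i: "i \<in> {M+1..N}" for i
    proof -
      have "(LINT x:?K i|\<mu> i. real_of_ereal (\<psi> i x)) \<le> (\<integral>x. h i n x \<partial>\<mu> i)"
        unfolding set_lebesgue_integral_def
      proof (rule integral_mono_AE)
        show "integrable (\<mu> i) (\<lambda>x. indicat_real (?K i) x *\<^sub>R real_of_ereal (\<psi> i x))"
          using \<psi>(5)[OF i] by (simp add: set_integrable_def)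
        show "integrable (\<mu> i) (h i n)"
          by (rule borel_probs_integrable[OF \<mu>[OF I2[OF i]] compact hcont[OF i]])
        show "AE x in \<mu> i. indicat_real (?K i) x *\<^sub>R real_of_ereal (\<psi> i x) \<le> h i n x"
          using K(3)[OF i] \<psi>(4)[OF i]
        proof eventually_elim
          case (elim x)
          then have "ereal (real_of_ereal (\<psi> i x)) \<le> ereal (h i n x)"
            using h(3)[OF i, of x n] by (simp add: ereal_real)
          then show ?case using elim by simp
        qed
      qed
      also have "\<dots> \<le> (\<integral>x. h i n x \<partial>marginal \<Omega> i \<gamma>)"
        by (rule cx_le_minus_convex[OF cx2[OF i] h(2)[OF i]])
      also have "\<dots> = (\<integral>x. h i n (x i) \<partial>\<gamma>)"
        by (rule integral_marginal[OF \<gamma>P I2[OF i] hcont[OF i]])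
      finally show ?thesis .
    qed
    have "(\<integral>x. F n x \<partial>\<gamma>) = (\<Sum>i=1..M. \<integral>x. \<phi> i (x i) \<partial>\<gamma>) + (\<Sum>i=M+1..N. \<integral>x. h i n (x i) \<partial>\<gamma>)"
      unfolding F_def using \<phi>(2) hcont I1 I2
      by (subst Bochner_Integration.integral_add Bochner_Integration.integral_sum,
          auto intro!: Bochner_Integration.integrable_sum integrable_marginal[OF compact \<gamma>P])+
    then show ?thesis by (simp only:) (intro add_mono sum_mono 1 2)
  qed
  have meas_c: "?c \<in> borel_measurable \<gamma>"
    using cbar_measurable measurable_cong_sets[OF \<gamma>D(2) refl] by blast
  define D where "D = (\<Sum>i=1..M. A i) + (\<Sum>i=M+1..N. B i)"
  have in\<Omega>: "x i \<in> \<Omega>" if "x \<in> space \<gamma>" "i \<in> {1..N}" for x i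
    using that \<gamma>D(3) by auto
  have bound: "\<bar>max (F n x) (?c x)\<bar> \<le> \<bar>D\<bar> + C" if x: "x \<in> space \<gamma>" for n x
  proof -
    have "F n x \<le> D"
      unfolding F_def D_def using A B in\<Omega>[OF x] I1 by (intro add_mono sum_mono) auto
    moreover have "0 \<le> ?c x" "?c x \<le> C" using cbar_nonneg C(2) in\<Omega>[OF x] by auto
    ultimately show ?thesis by (auto simp: max_def abs_if)
  qed
  have max_int: "integrable \<gamma> (\<lambda>x. max (F n x) (?c x))" for n
    using bound F_int meas_c by (intro \<gamma>.integrable_const_bound[of _ "\<bar>D\<bar> + C"] AE_I2) auto
  \<comment> \<open>The relaxed inequality is assumed only where these coordinates lie in the hulls.\<close>
  have AE_K: "AE x in \<gamma>. \<forall>i\<in>{M+1..N}. x i \<in> ?K i"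
  proof (rule AE_finite_allI)
    fix i assume i: "i \<in> {M+1..N}"
    have "AE x in marginal \<Omega> i \<gamma>. x \<in> ?K i"
      using K[OF i] by (intro cx_le_concentrated[OF compact marginal_borel_probs[OF \<gamma>P I2[OF i]] \<mu>[OF I2[OF i]] cx2[OF i]])
        (auto intro: compact_imp_closed)
    then show "AE x in \<gamma>. x i \<in> ?K i"
      unfolding marginal_def by (rule AE_distrD[OF \<gamma>D(4)[OF I2[OF i]]])
  qed simp
  have lim: "(\<lambda>n. max (F n x) (?c x)) \<longlonglongrightarrow> ?c x"
    if x: "x \<in> space \<gamma>" and xK: "\<forall>i\<in>{M+1..N}. x i \<in> ?K i" for x
  proof -
    let ?l = "\<Sum>i=M+1..N. \<psi> i (x i)"
    have "(\<lambda>n. \<Sum>i=M+1..N. ereal (h i n (x i))) \<longlonglongrightarrow> ?l"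
      using xK h(4) \<psi>(1) by (intro conjunct1[OF tendsto_sum_ereal_not_PInfty]) auto
    then have "(\<lambda>n. (\<Sum>i=1..M. ereal (\<phi> i (x i))) + (\<Sum>i=M+1..N. ereal (h i n (x i))))
        \<longlonglongrightarrow> (\<Sum>i=1..M. ereal (\<phi> i (x i))) + ?l"
      by (intro tendsto_add_ereal_general) (auto simp: sum_ereal)
    then have "(\<lambda>n. ereal (F n x)) \<longlonglongrightarrow> (\<Sum>i=1..M. ereal (\<phi> i (x i))) + ?l"
      by (simp add: F_def sum_ereal)
    then have "(\<lambda>n. max (ereal (F n x)) (ereal (?c x))) \<longlonglongrightarrow> max ((\<Sum>i=1..M. ereal (\<phi> i (x i))) + ?l) (ereal (?c x))"
      by (intro tendsto_max tendsto_const)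
    moreover have "(\<Sum>i=1..M. ereal (\<phi> i (x i))) + ?l \<le> ereal (?c x)"
    proof -
      have "x \<in> PiE {1..N} (\<lambda>i. if i \<le> M then \<Omega> else ?K i)"
        using x xK in\<Omega>[OF x] \<gamma>D(3) by (auto simp: PiE_iff)
      then show ?thesis using adm unfolding relaxed_admissible_def by blast
    qed
    ultimately have "(\<lambda>n. ereal (max (F n x) (?c x))) \<longlonglongrightarrow> ereal (?c x)"
      by (simp add: max_absorb2 ereal_max)
    then show ?thesis by (rule lim_ereal[THEN iffD1])
  qed
  have "(\<lambda>n. \<integral>x. max (F n x) (?c x) \<partial>\<gamma>) \<longlonglongrightarrow> (\<integral>x. ?c x \<partial>\<gamma>)"
  proof (rule integral_dominated_convergence)
    show "integrable \<gamma> (\<lambda>_. \<bar>D\<bar> + C)" by simp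
    show "AE x in \<gamma>. (\<lambda>n. max (F n x) (?c x)) \<longlonglongrightarrow> ?c x"
      using AE_K AE_space by eventually_elim (rule lim)
    show "AE x in \<gamma>. norm (max (F n x) (?c x)) \<le> \<bar>D\<bar> + C" for n
      using bound by (intro AE_I2) simp
  qed (use meas_c max_int in auto)
  moreover have "?V \<le> (\<integral>x. max (F n x) (?c x) \<partial>\<gamma>)" for n
    using V_le[of n] integral_mono[OF F_int max_int, of n n] by (force intro: order_trans)
  ultimately show ?thesis by (intro LIMSEQ_le_const) auto
qed

lemma wDr_le_wMM:
  fixes \<Omega> :: "'a::euclidean_space set"
  assumes "barycenter_cost \<Omega> N p w" "convex \<Omega>" "M \<le> N" "\<And>i. i \<in> {1..N} \<Longrightarrow> \<mu> i \<in> borel_probs \<Omega>"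
  shows "wDr \<Omega> M N p w \<mu> \<le> wMM \<Omega> M N p w \<mu>"
  unfolding wDr_def wMM_def
proof (intro SUP_least INF_greatest)
  fix q \<gamma> assume q: "q \<in> relaxed_admissible \<Omega> M N p w \<mu>" and \<gamma>: "\<gamma> \<in> cx_plans \<Omega> M N \<mu>"
  obtain \<phi> \<psi> where "q = (\<phi>, \<psi>)" by (cases q)
  then show "(case q of (\<phi>, \<psi>) \<Rightarrow> ereal ((\<Sum>i=1..M. \<integral>x. \<phi> i x \<partial>\<mu> i) +
      (\<Sum>i=M+1..N. LINT x:supp_hull (\<mu> i)|\<mu> i. real_of_ereal (\<psi> i x)))) \<le> ereal (\<integral>x. cbar \<Omega> N p w x \<partial>\<gamma>)"
    using relaxed_dual_le_plan[OF assms _ \<gamma>] q by simp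
qed

lemma wD_le_wDr:
  fixes \<Omega> :: "'a::euclidean_space set"
  assumes \<Omega>: "compact \<Omega>" "convex \<Omega>" and MN: "M \<le> N"
    and \<mu>: "\<And>i. i \<in> {1..N} \<Longrightarrow> \<mu> i \<in> borel_probs \<Omega>"
  shows "wD \<Omega> M N p w \<mu> \<le> wDr \<Omega> M N p w \<mu>"
  unfolding wD_def
proof (rule SUP_least)
  fix \<phi> assume \<phi>: "\<phi> \<in> dual_admissible \<Omega> M N p w"
  have split: "sum g {1..N} = sum g {1..M} + sum g {M+1..N}" for g :: "nat \<Rightarrow> real"
    using MN sum.ub_add_nat[of 1 M g "N - M"] by simp
  let ?K = "\<lambda>i. supp_hull (\<mu> i)" and ?\<psi> = "\<lambda>i x. ereal (\<phi> i x)"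
  have K: "compact (?K i)" "convex (?K i)" "AE x in \<mu> i. x \<in> ?K i" "?K i \<subseteq> \<Omega>" "?K i \<in> sets (\<mu> i)"
    if "i \<in> {M+1..N}" for i
    using supp_hull_props[OF \<mu> \<Omega>] that by auto
  have cont: "continuous_on \<Omega> (\<phi> i)" if "i \<in> {1..N}" for i
    using \<phi> that by (simp add: dual_admissible_def)
  have "(\<phi>, ?\<psi>) \<in> relaxed_admissible \<Omega> M N p w \<mu>"
    unfolding relaxed_admissible_def
  proof (intro CollectI case_prodI conjI ballI)
    fix i assume "i \<in> {1..M}"
    then show "convex_on \<Omega> (\<phi> i)" "continuous_on \<Omega> (\<phi> i)"
      using \<phi> MN by (auto simp: dual_admissible_def)
  next
    fix i assume i: "i \<in> {M+1..N}"
    then have i': "i \<in> {1..N}" by simp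
    show "?\<psi> i x \<noteq> \<infinity>" for x by simp
    have "concave_on \<Omega> (\<phi> i)" using \<phi> i by (simp add: dual_admissible_def)
    then have "concave_on (?K i) (\<phi> i)"
      unfolding concave_on_def using K(4)[OF i] K(2)[OF i] by (rule convex_on_subset)
    then show "ereal_concave_on (?K i) (?\<psi> i)" by (rule ereal_concave_on_ereal)
    show "usc_on (?K i) (?\<psi> i)"
      using continuous_on_subset[OF cont[OF i'] K(4)[OF i]] by (rule usc_on_ereal)
    show "ereal_L1_on (\<mu> i) (?K i) (?\<psi> i)"
      using integrable_mult_indicator[OF K(5)[OF i] borel_probs_integrable[OF \<mu>[OF i'] \<Omega>(1) cont[OF i']]]
      by (simp add: ereal_L1_on_def set_integrable_def)
  next
    fix x assume x: "x \<in> PiE {1..N} (\<lambda>i. if i \<le> M then \<Omega> else ?K i)"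
    have "x i \<in> \<Omega>" if "i \<in> {1..N}" for i
      using PiE_mem[OF x that] K(4)[of i] that by (cases "i \<le> M") auto
    then have "x \<in> PiE {1..N} (\<lambda>_. \<Omega>)" using x by (auto simp: PiE_iff)
    then have "(\<Sum>i=1..N. \<phi> i (x i)) \<le> cbar \<Omega> N p w x" using \<phi> by (simp add: dual_admissible_def)
    moreover have "(\<Sum>i=1..N. \<phi> i (x i)) = (\<Sum>i=1..M. \<phi> i (x i)) + (\<Sum>i=M+1..N. \<phi> i (x i))"
      by (rule split)
    ultimately show "(\<Sum>i=1..M. ereal (\<phi> i (x i))) + (\<Sum>i=M+1..N. ereal (\<phi> i (x i))) \<le> ereal (cbar \<Omega> N p w x)"
      by (simp add: sum_ereal)
  qed
  moreover have "(\<Sum>i=1..N. \<integral>x. \<phi> i x \<partial>\<mu> i) = (\<Sum>i=1..M. \<integral>x. \<phi> i x \<partial>\<mu> i) +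
      (\<Sum>i=M+1..N. LINT x:?K i|\<mu> i. real_of_ereal (?\<psi> i x))"
  proof -
    have "(LINT x:?K i|\<mu> i. real_of_ereal (?\<psi> i x)) = (\<integral>x. \<phi> i x \<partial>\<mu> i)" if i: "i \<in> {M+1..N}" for i
      unfolding set_lebesgue_integral_def
    proof (rule integral_cong_AE)
      have "\<phi> i \<in> borel_measurable (\<mu> i)"
        using i by (intro borel_probs_measurable[OF \<mu> cont]) auto
      then show "\<phi> i \<in> borel_measurable (\<mu> i)"
        "(\<lambda>x. indicat_real (?K i) x *\<^sub>R real_of_ereal (?\<psi> i x)) \<in> borel_measurable (\<mu> i)"
        using K(5)[OF i] by auto
      show "AE x in \<mu> i. indicat_real (?K i) x *\<^sub>R real_of_ereal (?\<psi> i x) = \<phi> i x"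
        using K(3)[OF i] by eventually_elim simp
    qed
    moreover have "(\<Sum>i=1..N. \<integral>x. \<phi> i x \<partial>\<mu> i) = (\<Sum>i=1..M. \<integral>x. \<phi> i x \<partial>\<mu> i) + (\<Sum>i=M+1..N. \<integral>x. \<phi> i x \<partial>\<mu> i)"
      by (rule split)
    ultimately show ?thesis by simp
  qed
  ultimately show "ereal (\<Sum>i=1..N. \<integral>x. \<phi> i x \<partial>\<mu> i) \<le> wDr \<Omega> M N p w \<mu>"
    unfolding wDr_def by (intro SUP_upper2[of "(\<phi>, ?\<psi>)"]) auto
qed

section \<open>Strong duality\<close>

text \<open>The families of dual potentials without the inequality constraint; unlike the admissible families they form
  a convex cone.\<close>
definition test_families :: "'a::euclidean_space set \<Rightarrow> nat \<Rightarrow> nat \<Rightarrow> (nat \<Rightarrow> 'a \<Rightarrow> real) set" where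
  "test_families \<Omega> M N = {\<Phi>. (\<forall>i\<in>{1..N}. continuous_on \<Omega> (\<Phi> i)) \<and>
     (\<forall>i\<in>{1..M}. convex_on \<Omega> (\<Phi> i)) \<and> (\<forall>i\<in>{M+1..N}. concave_on \<Omega> (\<Phi> i))}"

lemma dual_admissible_eq:
  "dual_admissible \<Omega> M N p w = {\<Phi> \<in> test_families \<Omega> M N.
     \<forall>x \<in> PiE {1..N} (\<lambda>_. \<Omega>). (\<Sum>i=1..N. \<Phi> i (x i)) \<le> cbar \<Omega> N p w x}"
  by (auto simp: dual_admissible_def test_families_def)

lemma test_families_const:
  assumes "convex \<Omega>"
  shows "(\<lambda>_ _. k) \<in> test_families \<Omega> M N"
  using assms by (auto simp: test_families_def convex_on_def concave_on_iff simp flip: distrib_right)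

lemma test_families_add:
  assumes "\<Phi> \<in> test_families \<Omega> M N" "\<Psi> \<in> test_families \<Omega> M N"
  shows "(\<lambda>i x. \<Phi> i x + \<Psi> i x) \<in> test_families \<Omega> M N"
  using assms unfolding test_families_def
  by (auto intro: continuous_on_add convex_on_add concave_on_add)

lemma test_families_scale:
  assumes "\<Phi> \<in> test_families \<Omega> M N" "0 \<le> s"
  shows "(\<lambda>i x. s * \<Phi> i x) \<in> test_families \<Omega> M N"
proof -
  have "convex_on \<Omega> (\<lambda>x. s * \<Phi> i x)" if "i \<in> {1..M}" for i
    using assms that by (intro convex_on_cmul) (auto simp: test_families_def)
  moreover have "concave_on \<Omega> (\<lambda>x. s * \<Phi> i x)" if "i \<in> {M+1..N}" for i
    using convex_on_cmul[of s \<Omega> "\<lambda>x. - \<Phi> i x"] assms that by (auto simp: test_families_def concave_on_def)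
  ultimately show ?thesis
    using assms(1) by (auto simp: test_families_def intro: continuous_on_mult_left)
qed

context barycenter_cost
begin

text \<open>Adding the same constant to all potentials turns the assumption into the dual constraint and makes the dual
  value equal to \<open>v\<close>.\<close>
lemma wD_ge:
  assumes M: "M \<le> N" and N: "0 < N" and \<Omega>: "convex \<Omega>"
    and \<mu>: "\<And>i. i \<in> {1..N} \<Longrightarrow> \<mu> i \<in> borel_probs \<Omega>"
    and \<Phi>: "\<Phi> \<in> test_families \<Omega> M N"
    and ge: "\<And>x. x \<in> PiE {1..N} (\<lambda>_. \<Omega>) \<Longrightarrow> v \<le> cbar \<Omega> N p w x + (\<Sum>i=1..N. (\<integral>y. \<Phi> i y \<partial>\<mu> i) - \<Phi> i (x i))"
  shows "ereal v \<le> wD \<Omega> M N p w \<mu>"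
proof -
  let ?k = "(v - (\<Sum>i=1..N. \<integral>y. \<Phi> i y \<partial>\<mu> i)) / real N"
  let ?\<Psi> = "\<lambda>i y. \<Phi> i y + ?k"
  have "?\<Psi> \<in> test_families \<Omega> M N"
    using test_families_add[OF \<Phi> test_families_const[OF \<Omega>]] .
  moreover have "(\<Sum>i=1..N. ?\<Psi> i (x i)) \<le> cbar \<Omega> N p w x" if "x \<in> PiE {1..N} (\<lambda>_. \<Omega>)" for x
    using ge[OF that] N by (simp add: sum.distrib sum_subtractf)
  ultimately have "?\<Psi> \<in> dual_admissible \<Omega> M N p w" by (simp add: dual_admissible_eq)
  moreover have "(\<Sum>i=1..N. \<integral>y. ?\<Psi> i y \<partial>\<mu> i) = v"
  proof -
    have "(\<integral>y. ?\<Psi> i y \<partial>\<mu> i) = (\<integral>y. \<Phi> i y \<partial>\<mu> i) + ?k" if i: "i \<in> {1..N}" for i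
    proof -
      interpret prob_space "\<mu> i" using \<mu>[OF i] by (rule borel_probsD)
      have "integrable (\<mu> i) (\<Phi> i)"
        using \<Phi> i by (intro borel_probs_integrable[OF \<mu>[OF i] compact]) (simp add: test_families_def)
      then show ?thesis by (simp add: prob_space)
    qed
    then have "(\<Sum>i=1..N. \<integral>y. ?\<Psi> i y \<partial>\<mu> i) = (\<Sum>i=1..N. (\<integral>y. \<Phi> i y \<partial>\<mu> i) + ?k)"
      by (rule sum.cong[OF refl])
    then show ?thesis using N by (simp add: sum.distrib)
  qed
  ultimately show ?thesis
    unfolding wD_def by (intro SUP_upper2[of ?\<Psi>]) auto
qed

lemma wD_nonneg:
  assumes M: "M \<le> N" and N: "0 < N" and \<Omega>: "convex \<Omega>"
    and \<mu>: "\<And>i. i \<in> {1..N} \<Longrightarrow> \<mu> i \<in> borel_probs \<Omega>"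
  shows "0 \<le> wD \<Omega> M N p w \<mu>"
  unfolding zero_ereal_def
proof (rule wD_ge[OF M N \<Omega>])
  show "(\<lambda>_ _. 0) \<in> test_families \<Omega> M N" using \<Omega> by (rule test_families_const)
qed (use \<mu> cbar_nonneg in simp_all)

text \<open>The separation hypothesis of the Hahn-Banach argument. A positive lower bound \<open>\<delta>\<close> would contradict the
  definition of \<open>v\<close> after rescaling the potentials: for \<open>a > 0\<close> the factor is \<open>1 / a\<close>. For \<open>a = 0\<close> any
  large multiple of the potentials has a large gap, and \<open>(v + 1) / \<delta>\<close> is enough because the cost is nonnegative.\<close>
lemma test_gap_not_positive:
  assumes M: "M \<le> N" and N: "0 < N" and \<Omega>: "convex \<Omega>"
    and \<mu>: "\<And>i. i \<in> {1..N} \<Longrightarrow> \<mu> i \<in> borel_probs \<Omega>"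
    and \<Phi>: "\<Phi> \<in> test_families \<Omega> M N" and a: "0 \<le> a" and v: "wD \<Omega> M N p w \<mu> = ereal v" and \<delta>: "0 < \<delta>"
  shows "\<exists>x\<in>PiE {1..N} (\<lambda>_. \<Omega>). a * (cbar \<Omega> N p w x - v) + (\<Sum>i=1..N. (\<integral>y. \<Phi> i y \<partial>\<mu> i) - \<Phi> i (x i)) < \<delta>"
proof (rule ccontr)
  let ?S = "\<lambda>x. \<Sum>i=1..N. (\<integral>y. \<Phi> i y \<partial>\<mu> i) - \<Phi> i (x i)"
  assume "\<not> ?thesis"
  then have ge: "\<delta> \<le> a * (cbar \<Omega> N p w x - v) + ?S x" if "x \<in> PiE {1..N} (\<lambda>_. \<Omega>)" for x
    using that by (auto simp: not_less)
  have "0 \<le> wD \<Omega> M N p w \<mu>" using \<mu> by (rule wD_nonneg[OF M N \<Omega>])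
  then have v0: "0 \<le> v" using v by simp
  define s where "s = (if a = 0 then (v + 1) / \<delta> else 1 / a)"
  define \<delta>' where "\<delta>' = (if a = 0 then 1 else \<delta> / a)"
  have s: "0 \<le> s" and \<delta>': "0 < \<delta>'" using v0 \<delta> a by (auto simp: s_def \<delta>'_def)
  have "v + \<delta>' \<le> cbar \<Omega> N p w x + s * ?S x" if x: "x \<in> PiE {1..N} (\<lambda>_. \<Omega>)" for x
  proof (cases "a = 0")
    case True
    then have "v + 1 \<le> s * ?S x" using ge[OF x] v0 \<delta> mult_left_mono[OF ge[OF x] s] by (simp add: s_def)
    then show ?thesis using cbar_nonneg[of x] True by (simp add: \<delta>'_def)
  next
    case False
    then have "\<delta>' \<le> (cbar \<Omega> N p w x - v) + s * ?S x"
      using mult_left_mono[OF ge[OF x] s] a by (simp add: s_def \<delta>'_def field_simps)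
    then show ?thesis by simp
  qed
  moreover have "s * ?S x = (\<Sum>i=1..N. (\<integral>y. s * \<Phi> i y \<partial>\<mu> i) - s * \<Phi> i (x i))" for x
    by (simp add: sum_distrib_left right_diff_distrib)
  ultimately have "ereal (v + \<delta>') \<le> wD \<Omega> M N p w \<mu>"
    by (intro wD_ge[OF M N \<Omega> _ test_families_scale[OF \<Phi> s]] \<mu>) auto
  then show False using v \<delta>' by simp
qed

lemma cbar_continuous_along:
  fixes q :: "'b::topological_space \<Rightarrow> nat \<Rightarrow> 'a"
  assumes q: "\<And>i. i \<in> {1..N} \<Longrightarrow> continuous_on UNIV (\<lambda>b. q b i)" "\<And>b i. i \<in> {1..N} \<Longrightarrow> q b i \<in> \<Omega>"
  shows "continuous_on UNIV (\<lambda>b. cbar \<Omega> N p w (q b))"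
  unfolding continuous_on_def
proof (intro ballI tendstoI)
  fix b and e :: real assume e: "0 < e"
  obtain \<delta> where \<delta>: "0 < \<delta>" "\<And>x y. (\<And>i. i \<in> {1..N} \<Longrightarrow> x i \<in> \<Omega> \<and> y i \<in> \<Omega> \<and> dist (x i) (y i) < \<delta>) \<Longrightarrow>
    \<bar>cbar \<Omega> N p w x - cbar \<Omega> N p w y\<bar> \<le> e/2"
    using cbar_uniformly_continuous[of "e/2"] e by (metis half_gt_zero)
  have "\<forall>\<^sub>F b' in at b. dist (q b' i) (q b i) < \<delta>" if "i \<in> {1..N}" for i
    using tendstoD[OF q(1)[OF that, unfolded continuous_on_def, rule_format, OF UNIV_I] \<delta>(1)] .
  then have "\<forall>\<^sub>F b' in at b. \<forall>i\<in>{1..N}. dist (q b' i) (q b i) < \<delta>"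
    by (intro eventually_ball_finite) auto
  then show "\<forall>\<^sub>F b' in at b. dist (cbar \<Omega> N p w (q b')) (cbar \<Omega> N p w (q b)) < e"
  proof eventually_elim
    case (elim b')
    have "\<bar>cbar \<Omega> N p w (q b') - cbar \<Omega> N p w (q b)\<bar> \<le> e/2"
      using elim q(2) by (intro \<delta>(2)) auto
    then show ?case using e by (simp add: dist_real_def)
  qed
qed

text \<open>The functional of the Hahn-Banach argument is represented by a measure \<open>m\<close> on the cube whose points code,
  through \<open>q\<close>, the \<open>N\<close>-tuples of points of \<open>\<Omega>\<close>, and \<open>\<gamma>\<close> is its image. Testing with \<open>a = 1\<close> and zero
  potentials bounds the cost; testing with \<open>a = 0\<close> and a single nonzero potential gives the two
  convex order constraints.\<close>
lemma wMM_le_wD: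
  assumes M: "M \<le> N" and N: "0 < N" and \<Omega>: "convex \<Omega>"
    and \<mu>: "\<And>i. i \<in> {1..N} \<Longrightarrow> \<mu> i \<in> borel_probs \<Omega>"
  shows "wMM \<Omega> M N p w \<mu> \<le> wD \<Omega> M N p w \<mu>"
proof (cases "wD \<Omega> M N p w \<mu>")
  case (real v)
  let ?P = "PiM {1..N} (\<lambda>_. restrict_space borel \<Omega>)"
  obtain D :: "('a \<times> nat \<Rightarrow> bool) \<Rightarrow> 'a" where D: "continuous_on UNIV D" "range D = \<Omega>"
    using compact_convex_cantor_image[OF compact \<Omega> nonempty] .
  define q :: "(nat \<times> 'a \<times> nat \<Rightarrow> bool) \<Rightarrow> nat \<Rightarrow> 'a" where "q b i = D (\<lambda>k. b (i, k))" for b i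
  have q\<Omega>: "q b i \<in> \<Omega>" for b i using D(2) by (auto simp: q_def)
  have q_cont: "continuous_on UNIV (\<lambda>b. q b i)" for i
  proof -
    have "continuous_on UNIV (\<lambda>(b :: nat \<times> 'a \<times> nat \<Rightarrow> bool) k. b (i, k))"
      by (intro continuous_on_coordinatewise_then_product continuous_on_product_coordinates)
    then show ?thesis
      unfolding q_def using continuous_on_compose2[OF D(1)] by blast
  qed
  have q_surj: "\<exists>b. \<forall>i\<in>{1..N}. q b i = x i" if x: "x \<in> PiE {1..N} (\<lambda>_. \<Omega>)" for x
  proof -
    have "\<exists>b. D b = x i" if "i \<in> {1..N}" for i using PiE_mem[OF x that] D(2) by (metis imageE)
    then obtain b where "\<And>i. i \<in> {1..N} \<Longrightarrow> D (b i) = x i" by metis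
    then show ?thesis by (intro exI[of _ "\<lambda>(i, k). b i k"]) (simp add: q_def)
  qed
  \<comment> \<open>The functions of the cone, before they are pulled back to the cube along \<open>q\<close>.\<close>
  define G where "G a \<Phi> x = a * (cbar \<Omega> N p w x - v) + (\<Sum>i=1..N. (\<integral>y. \<Phi> i y \<partial>\<mu> i) - \<Phi> i (x i))"
    for a \<Phi> x
  have G_cong: "G a \<Phi> x = G a \<Phi> y" if xy: "\<And>i. i \<in> {1..N} \<Longrightarrow> x i = y i" for a \<Phi> x y
  proof -
    have "(\<Sum>i=1..N. w i * norm (x i - z) powr p) = (\<Sum>i=1..N. w i * norm (y i - z) powr p)" for z
      by (rule sum.cong) (simp_all add: xy)
    moreover have "(\<Sum>i=1..N. (\<integral>u. \<Phi> i u \<partial>\<mu> i) - \<Phi> i (x i)) = (\<Sum>i=1..N. (\<integral>u. \<Phi> i u \<partial>\<mu> i) - \<Phi> i (y i))"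
      by (rule sum.cong) (simp_all add: xy)
    ultimately show ?thesis unfolding G_def cbar_def by (simp only:)
  qed
  let ?C = "{g. \<exists>a\<ge>0. \<exists>\<Phi>\<in>test_families \<Omega> M N. \<forall>b. apply_bcontfun g b = G a \<Phi> (q b)}"
  have int_\<Phi>: "integrable (\<mu> i) (\<Phi> i)" if "\<Phi> \<in> test_families \<Omega> M N" "i \<in> {1..N}" for \<Phi> i
    using that by (intro borel_probs_integrable[OF \<mu> compact]) (auto simp: test_families_def)
  have c_cont: "continuous_on UNIV (\<lambda>b. cbar \<Omega> N p w (q b))"
    using q_cont q\<Omega> by (intro cbar_continuous_along)
  have \<Phi>_cont: "continuous_on UNIV (\<lambda>b. \<phi> (q b i))" if "continuous_on \<Omega> \<phi>" for \<phi> :: "'a \<Rightarrow> real" and i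
    using q\<Omega> by (intro continuous_on_compose2[OF that q_cont]) auto
  have G_cont: "continuous_on UNIV (\<lambda>b. G a \<Phi> (q b))" if "\<Phi> \<in> test_families \<Omega> M N" for a \<Phi>
    unfolding G_def using that by (intro continuous_intros c_cont \<Phi>_cont) (auto simp: test_families_def)
  have bcont: "f \<in> bcontfun" if "continuous_on UNIV f" for f :: "(nat \<times> 'a \<times> nat \<Rightarrow> bool) \<Rightarrow> real"
    using that compact_imp_bounded[OF compact_continuous_image[OF that compact_cantor]]
    by (simp add: bcontfun_def)
  have C_zero: "0 \<in> ?C"
    using test_families_const[OF \<Omega>, of 0]
    by (auto simp: G_def intro!: exI[of _ 0] bexI[of _ "\<lambda>_ _. 0"])
  have C_add: "g + h \<in> ?C" if "g \<in> ?C" "h \<in> ?C" for g h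
  proof -
    from that obtain a \<Phi> a' \<Phi>' where *: "0 \<le> a" "\<Phi> \<in> test_families \<Omega> M N" "\<And>b. apply_bcontfun g b = G a \<Phi> (q b)"
      "0 \<le> a'" "\<Phi>' \<in> test_families \<Omega> M N" "\<And>b. apply_bcontfun h b = G a' \<Phi>' (q b)" by auto
    have "G a \<Phi> x + G a' \<Phi>' x = G (a + a') (\<lambda>i y. \<Phi> i y + \<Phi>' i y) x" for x
      using int_\<Phi>[OF *(2)] int_\<Phi>[OF *(5)]
      by (simp add: G_def algebra_simps sum.distrib sum_subtractf)
    then show ?thesis
      using * test_families_add[OF *(2,5)]
      by (auto intro!: exI[of _ "a + a'"] bexI[of _ "\<lambda>i y. \<Phi> i y + \<Phi>' i y"])
  qed
  have C_scale: "s *\<^sub>R g \<in> ?C" if s: "0 \<le> s" and g: "g \<in> ?C" for s g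
  proof -
    from g obtain a \<Phi> where *: "0 \<le> a" "\<Phi> \<in> test_families \<Omega> M N" "\<And>b. apply_bcontfun g b = G a \<Phi> (q b)"
      by auto
    have "s * G a \<Phi> x = G (s * a) (\<lambda>i y. s * \<Phi> i y) x" for x
      by (simp add: G_def distrib_left sum_distrib_left right_diff_distrib mult.assoc)
    then show ?thesis
      using * s test_families_scale[OF *(2) s]
      by (auto intro!: exI[of _ "s * a"] bexI[of _ "\<lambda>i y. s * \<Phi> i y"])
  qed
  have C_gap: "\<exists>b. apply_bcontfun g b < \<delta>" if g: "g \<in> ?C" and \<delta>: "0 < \<delta>" for g \<delta>
  proof -
    from g obtain a \<Phi> where *: "0 \<le> a" "\<Phi> \<in> test_families \<Omega> M N" "\<And>b. apply_bcontfun g b = G a \<Phi> (q b)"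
      by auto
    obtain x where x: "x \<in> PiE {1..N} (\<lambda>_. \<Omega>)" "G a \<Phi> x < \<delta>"
      using test_gap_not_positive[OF M N \<Omega> _ *(2,1) real \<delta>] \<mu> by (auto simp: G_def)
    obtain b where "\<And>i. i \<in> {1..N} \<Longrightarrow> q b i = x i" using q_surj[OF x(1)] by blast
    then have "G a \<Phi> (q b) = G a \<Phi> x" by (rule G_cong)
    then show ?thesis using *(3) x(2) by metis
  qed
  obtain L :: "((nat \<times> 'a \<times> nat \<Rightarrow> bool) \<Rightarrow>\<^sub>C real) \<Rightarrow> real" where L: "linear L"
    "\<And>f t. (\<And>b. apply_bcontfun f b \<le> t) \<Longrightarrow> L f \<le> t" "\<And>g. g \<in> ?C \<Longrightarrow> L g \<le> 0"
  proof (rule positive_functional_nonpos_on_cone[of ?C, OF C_zero C_add C_scale C_gap])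
    fix L assume L: "linear L" "\<And>f t. (\<And>b. apply_bcontfun f b \<le> t) \<Longrightarrow> L f \<le> t"
      "\<And>g. g \<in> ?C \<Longrightarrow> L g \<le> 0"
    show thesis by (rule that[OF L])
  qed
  obtain m where m: "prob_space m" "space m = UNIV"
    "\<And>f :: (nat \<times> 'a \<times> nat \<Rightarrow> bool) \<Rightarrow> real. continuous_on UNIV f \<Longrightarrow> f \<in> borel_measurable m"
    "\<And>f. (\<integral>x. apply_bcontfun f x \<partial>m) = L f"
  proof (rule cantor_riesz[OF L(1,2)])
    fix m :: "(nat \<times> 'a \<times> nat \<Rightarrow> bool) measure"
    assume m: "prob_space m" "space m = UNIV"
      "\<And>f :: (nat \<times> 'a \<times> nat \<Rightarrow> bool) \<Rightarrow> real. continuous_on UNIV f \<Longrightarrow> f \<in> borel_measurable m"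
      "\<And>f. (\<integral>x. apply_bcontfun f x \<partial>m) = L f"
    show thesis by (rule that[OF m])
  qed
  interpret m: prob_space m by (rule m(1))
  have m_int: "integrable m f" if f: "continuous_on UNIV f" for f :: "(nat \<times> 'a \<times> nat \<Rightarrow> bool) \<Rightarrow> real"
  proof -
    obtain B where "\<And>b. norm (f b) \<le> B" using bcont[OF f] by (auto simp: bcontfun_def bounded_iff)
    then show ?thesis using m(3)[OF f] by (intro m.integrable_const_bound[of _ B]) auto
  qed
  have G_le: "(\<integral>b. G a \<Phi> (q b) \<partial>m) \<le> 0" if a\<Phi>: "0 \<le> a" "\<Phi> \<in> test_families \<Omega> M N" for a \<Phi>
  proof -
    obtain g where g: "(\<lambda>b. G a \<Phi> (q b)) = apply_bcontfun g"
      using bcont[OF G_cont[OF a\<Phi>(2)]] by (rule bcontfunE)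
    then have "\<forall>b. apply_bcontfun g b = G a \<Phi> (q b)" by metis
    then have "g \<in> ?C" using a\<Phi> by blast
    then show ?thesis using L(3) m(4)[of g] by (simp add: g)
  qed
  define T where "T b = restrict (q b) {1..N}" for b
  have T: "T \<in> measurable m ?P"
    unfolding T_def
  proof (rule measurable_restrict)
    fix i
    have "(\<lambda>b. q b i) \<in> borel_measurable m"
      unfolding borel_measurable_euclidean_space[of "\<lambda>b. q b i"]
      by (intro ballI m(3) continuous_intros q_cont)
    then show "(\<lambda>b. q b i) \<in> measurable m (restrict_space borel \<Omega>)"
      using q\<Omega> by (intro measurable_restrict_space2) auto
  qed
  define \<gamma> where "\<gamma> = distr m ?P T"
  have \<gamma>P: "\<gamma> \<in> borel_probs_prod \<Omega> N"
    using m.prob_space_distr[OF T] by (simp add: borel_probs_prod_def \<gamma>_def)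
  have cost: "(\<integral>x. cbar \<Omega> N p w x \<partial>\<gamma>) \<le> v"
  proof -
    have "(\<integral>x. cbar \<Omega> N p w x \<partial>\<gamma>) = (\<integral>b. cbar \<Omega> N p w (T b) \<partial>m)"
      unfolding \<gamma>_def by (rule integral_distr[OF T cbar_measurable])
    also have "\<dots> = (\<integral>b. cbar \<Omega> N p w (q b) \<partial>m)"
      by (simp add: cbar_def T_def)
    also have "\<dots> \<le> v"
    proof -
      have "(\<integral>b. cbar \<Omega> N p w (q b) - v \<partial>m) \<le> 0"
        using G_le[of 1 "\<lambda>_ _. 0"] test_families_const[OF \<Omega>, of 0] by (simp add: G_def)
      then show ?thesis using m_int[OF c_cont] by (simp add: m.prob_space)
    qed
    finally show ?thesis .
  qed
  have marg: "(\<integral>x. \<phi> x \<partial>marginal \<Omega> i \<gamma>) = (\<integral>b. \<phi> (q b i) \<partial>m)"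
    if i: "i \<in> {1..N}" and \<phi>: "continuous_on \<Omega> \<phi>" for \<phi> :: "'a \<Rightarrow> real" and i
  proof -
    have "(\<lambda>x. \<phi> (x i)) \<in> borel_measurable ?P"
      using measurable_compose[OF measurable_component_singleton[OF i] borel_measurable_continuous_on_restrict[OF \<phi>]] .
    then have "(\<integral>x. \<phi> (x i) \<partial>\<gamma>) = (\<integral>b. \<phi> (T b i) \<partial>m)"
      unfolding \<gamma>_def by (rule integral_distr[OF T])
    then show ?thesis using integral_marginal[OF \<gamma>P i \<phi>] i by (simp add: T_def)
  qed
  have single: "(\<integral>y. \<phi> y \<partial>\<mu> i) \<le> (\<integral>x. \<phi> x \<partial>marginal \<Omega> i \<gamma>)"
    if i: "i \<in> {1..N}" and \<phi>: "continuous_on \<Omega> \<phi>"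
      "i \<le> M \<Longrightarrow> convex_on \<Omega> \<phi>" "M < i \<Longrightarrow> concave_on \<Omega> \<phi>" for \<phi> :: "'a \<Rightarrow> real" and i
  proof -
    let ?\<Phi> = "\<lambda>j. if j = i then \<phi> else (\<lambda>_. 0)"
    have "?\<Phi> \<in> test_families \<Omega> M N"
      using \<phi> test_families_const[OF \<Omega>, of 0 M N] by (auto simp: test_families_def)
    then have "(\<integral>b. G 0 ?\<Phi> (q b) \<partial>m) \<le> 0" by (intro G_le) simp
    moreover have "G 0 ?\<Phi> (q b) = (\<integral>y. \<phi> y \<partial>\<mu> i) - \<phi> (q b i)" for b
    proof -
      have "G 0 ?\<Phi> (q b) = (\<Sum>j=1..N. if j = i then (\<integral>y. \<phi> y \<partial>\<mu> i) - \<phi> (q b i) else 0)"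
        unfolding G_def mult_zero_left add_0 by (rule sum.cong) auto
      then show ?thesis using i by simp
    qed
    ultimately show ?thesis
      using m_int[OF \<Phi>_cont[OF \<phi>(1)]] marg[OF i \<phi>(1)] by (simp add: m.prob_space)
  qed
  have "\<gamma> \<in> cx_plans \<Omega> M N \<mu>"
    unfolding cx_plans_def
  proof (intro CollectI conjI ballI \<gamma>P)
    fix i assume i: "i \<in> {1..M}"
    show "\<mu> i \<le>cx marginal \<Omega> i \<gamma>"
      unfolding cx_le_def
    proof (intro allI impI)
      fix \<phi> :: "'a \<Rightarrow> real" assume \<phi>: "convex_on UNIV \<phi>"
      show "(\<integral>x. \<phi> x \<partial>\<mu> i) \<le> (\<integral>x. \<phi> x \<partial>marginal \<Omega> i \<gamma>)"
        using i M \<phi> \<Omega> by (intro single) (auto intro: convex_on_UNIV_continuous convex_on_subset)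
    qed
  next
    fix i assume i: "i \<in> {M+1..N}"
    show "marginal \<Omega> i \<gamma> \<le>cx \<mu> i"
      unfolding cx_le_def
    proof (intro allI impI)
      fix \<phi> :: "'a \<Rightarrow> real" assume \<phi>: "convex_on UNIV \<phi>"
      have "(\<integral>x. - \<phi> x \<partial>\<mu> i) \<le> (\<integral>x. - \<phi> x \<partial>marginal \<Omega> i \<gamma>)"
        using i \<phi> \<Omega> by (intro single continuous_on_minus)
          (auto simp: concave_on_def intro: convex_on_UNIV_continuous convex_on_subset)
      then show "(\<integral>x. \<phi> x \<partial>marginal \<Omega> i \<gamma>) \<le> (\<integral>x. \<phi> x \<partial>\<mu> i)" by simp
    qed
  qed
  then have "wMM \<Omega> M N p w \<mu> \<le> ereal (\<integral>x. cbar \<Omega> N p w x \<partial>\<gamma>)"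
    unfolding wMM_def by (rule INF_lower)
  also have "\<dots> \<le> ereal v" using cost by simp
  finally show ?thesis using real by simp
next
  case PInf
  then show ?thesis by simp
next
  case MInf
  moreover have "0 \<le> wD \<Omega> M N p w \<mu>" using \<mu> by (rule wD_nonneg[OF M N \<Omega>])
  ultimately show ?thesis by simp
qed

end

theorem theorem3p3:
  fixes \<Omega> :: "(real ^ 'd) set" and M N :: nat and p :: real
    and w :: "nat \<Rightarrow> real" and \<mu> :: "nat \<Rightarrow> (real ^ 'd) measure"
  assumes "compact \<Omega>" and "convex \<Omega>"
    and "M \<le> N" and "0 < N"
    and "1 < p"
    and "\<forall>i\<in>{1..N}. \<mu> i \<in> borel_probs \<Omega>"
    and "w \<in> open_simplex N"
  shows "wMM \<Omega> M N p w \<mu> = wD \<Omega> M N p w \<mu> \<and> wD \<Omega> M N p w \<mu> = wDr \<Omega> M N p w \<mu>"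
proof -
  have \<mu>: "\<mu> i \<in> borel_probs \<Omega>" if "i \<in> {1..N}" for i using assms(6) that by blast
  interpret \<mu>1: prob_space "\<mu> 1" using \<mu>[of 1] assms(4) by (intro borel_probsD) auto
  have "\<Omega> \<noteq> {}" using \<mu>1.not_empty borel_probsD(2)[OF \<mu>[of 1]] assms(4) by simp
  then have bc: "barycenter_cost \<Omega> N p w"
    using assms by unfold_locales (auto simp: open_simplex_def intro: less_imp_le)
  have "wMM \<Omega> M N p w \<mu> \<le> wD \<Omega> M N p w \<mu>"
    using \<mu> by (rule barycenter_cost.wMM_le_wD[OF bc assms(3,4,2)])
  moreover have "wD \<Omega> M N p w \<mu> \<le> wDr \<Omega> M N p w \<mu>"
    using \<mu> by (rule wD_le_wDr[OF assms(1,2,3)])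
  moreover have "wDr \<Omega> M N p w \<mu> \<le> wMM \<Omega> M N p w \<mu>"
    using \<mu> by (rule wDr_le_wMM[OF bc assms(2,3)])
  ultimately show ?thesis by (auto intro: antisym order_trans)
qed

end
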